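(* $\textsc{\#MonotoneSat}$ is hard for $\#\mathsf{\Pi_2\text{-}1VAR}$ under product reductions: for every $\#B\in\#\mathsf{\Pi_2\text{-}1VAR}$ (over a vocabulary $\sigma$) there are polynomial-time computable functions $g,h$ such that for every input $\sigma$-structure $\mathcal{A}$, $g(\mathcal{A})$ is a monotone CNF formula and $\#B(\mathcal{A})=\textsc{\#MonotoneSat}(g(\mathcal{A}))\cdot h(\mathcal{A})$.
   Context: $\textsc{\#MonotoneSat}$: given a propositional CNF formula in which all literals are positive, output its number of satisfying assignments. A counting problem $\#B$ on finite ordered $\sigma$-structures belongs to $\#\mathsf{\Pi_2\text{-}1VAR}$ if there is a formula $\psi(\vec y,\vec z,X)=\phi(\vec y,\vec z)\wedge X(\vec z)$, with $\phi$ a first-order formula over $\sigma$ and $X$ a single second-order variable (occurring positively), such that for every input structure $\mathcal{A}$, $\#B(\mathcal{A})=|\{\langle X\rangle : \mathcal{A}\models\forall\vec y\exists\vec z\,\psi(\vec y,\vec z,X)\}|$. A product reduction from $f$ to $g'$ is a pair of polynomial-time computable functions $h_1,h_2$ with $f(x)=g'(h_1(x))\cdot h_2(x)$ for all $x$. *)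

theory Defs
  imports Complex_Main "HOL-Computational_Algebra.Polynomial"
begin

section \<open>Finite ordered structures\<close>

text \<open>Relation symbol \<open>i\<close> has arity \<open>rel_arities \<sigma> ! i\<close>. The order of an ordered structure is not listed
  in the vocabulary: it is a component of every structure, and formulas have their own atom for it.\<close>

record vocabulary =
  rel_arities :: "nat list"
  const_count :: nat

record 'a ordered_struct =
  universe :: "'a set"
  less_eq_rel :: "'a rel"
  rel_vals :: "'a list set list"
  const_vals :: "'a list"

definition tuples :: "'a set \<Rightarrow> nat \<Rightarrow> 'a list set" where
  "tuples U k = {t. length t = k \<and> set t \<subseteq> U}"

definition structures :: "vocabulary \<Rightarrow> 'a ordered_struct set" where
  "structures \<sigma> = {A. finite (universe A) \<and> universe A \<noteq> {} \<and>
     linear_order_on (universe A) (less_eq_rel A) \<and>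
     length (rel_vals A) = length (rel_arities \<sigma>) \<and>
     (\<forall>i < length (rel_arities \<sigma>). rel_vals A ! i \<subseteq> tuples (universe A) (rel_arities \<sigma> ! i)) \<and>
     length (const_vals A) = const_count \<sigma> \<and>
     set (const_vals A) \<subseteq> universe A}"


section \<open>Formulas\<close>

datatype trm = Var nat | Con nat

text \<open>Variables are named by natural numbers. \<open>SOAtom ts\<close> is the atom \<open>X(ts)\<close> for the only
  second-order variable \<open>X\<close>; the first-order formulas are those without such an atom.\<close>

datatype form =
    Eq trm trm
  | Le trm trm
  | RelAtom nat "trm list"
  | SOAtom "trm list"
  | Neg form
  | Conj form form
  | Disj form form
  | Exists nat form
  | Forall nat form

fun trm_vars :: "trm \<Rightarrow> nat set" where
  "trm_vars (Var v) = {v}"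
| "trm_vars (Con c) = {}"

fun free_vars :: "form \<Rightarrow> nat set" where
  "free_vars (Eq s t) = trm_vars s \<union> trm_vars t"
| "free_vars (Le s t) = trm_vars s \<union> trm_vars t"
| "free_vars (RelAtom i ts) = (\<Union>t \<in> set ts. trm_vars t)"
| "free_vars (SOAtom ts) = (\<Union>t \<in> set ts. trm_vars t)"
| "free_vars (Neg \<phi>) = free_vars \<phi>"
| "free_vars (Conj \<phi> \<psi>) = free_vars \<phi> \<union> free_vars \<psi>"
| "free_vars (Disj \<phi> \<psi>) = free_vars \<phi> \<union> free_vars \<psi>"
| "free_vars (Exists v \<phi>) = free_vars \<phi> - {v}"
| "free_vars (Forall v \<phi>) = free_vars \<phi> - {v}"

fun trm_over :: "vocabulary \<Rightarrow> trm \<Rightarrow> bool" where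
  "trm_over \<sigma> (Var v) = True"
| "trm_over \<sigma> (Con c) = (c < const_count \<sigma>)"

fun first_order_over :: "vocabulary \<Rightarrow> form \<Rightarrow> bool" where
  "first_order_over \<sigma> (Eq s t) = (trm_over \<sigma> s \<and> trm_over \<sigma> t)"
| "first_order_over \<sigma> (Le s t) = (trm_over \<sigma> s \<and> trm_over \<sigma> t)"
| "first_order_over \<sigma> (RelAtom i ts) =
     (i < length (rel_arities \<sigma>) \<and> length ts = rel_arities \<sigma> ! i \<and> (\<forall>t \<in> set ts. trm_over \<sigma> t))"
| "first_order_over \<sigma> (SOAtom ts) = False"
| "first_order_over \<sigma> (Neg \<phi>) = first_order_over \<sigma> \<phi>"
| "first_order_over \<sigma> (Conj \<phi> \<psi>) = (first_order_over \<sigma> \<phi> \<and> first_order_over \<sigma> \<psi>)"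
| "first_order_over \<sigma> (Disj \<phi> \<psi>) = (first_order_over \<sigma> \<phi> \<and> first_order_over \<sigma> \<psi>)"
| "first_order_over \<sigma> (Exists v \<phi>) = first_order_over \<sigma> \<phi>"
| "first_order_over \<sigma> (Forall v \<phi>) = first_order_over \<sigma> \<phi>"

fun trm_val :: "'a ordered_struct \<Rightarrow> (nat \<Rightarrow> 'a) \<Rightarrow> trm \<Rightarrow> 'a" where
  "trm_val A e (Var v) = e v"
| "trm_val A e (Con c) = const_vals A ! c"

fun holds :: "'a ordered_struct \<Rightarrow> 'a list set \<Rightarrow> (nat \<Rightarrow> 'a) \<Rightarrow> form \<Rightarrow> bool" where
  "holds A X e (Eq s t) = (trm_val A e s = trm_val A e t)"
| "holds A X e (Le s t) = ((trm_val A e s, trm_val A e t) \<in> less_eq_rel A)"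
| "holds A X e (RelAtom i ts) = (map (trm_val A e) ts \<in> rel_vals A ! i)"
| "holds A X e (SOAtom ts) = (map (trm_val A e) ts \<in> X)"
| "holds A X e (Neg \<phi>) = (\<not> holds A X e \<phi>)"
| "holds A X e (Conj \<phi> \<psi>) = (holds A X e \<phi> \<and> holds A X e \<psi>)"
| "holds A X e (Disj \<phi> \<psi>) = (holds A X e \<phi> \<or> holds A X e \<psi>)"
| "holds A X e (Exists v \<phi>) = (\<exists>a \<in> universe A. holds A X (e(v := a)) \<phi>)"
| "holds A X e (Forall v \<phi>) = (\<forall>a \<in> universe A. holds A X (e(v := a)) \<phi>)"

definition models :: "'a ordered_struct \<Rightarrow> 'a list set \<Rightarrow> form \<Rightarrow> bool" where
  "models A X \<phi> \<longleftrightarrow> (\<forall>e. range e \<subseteq> universe A \<longrightarrow> holds A X e \<phi>)"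


section \<open>The class of counting problems\<close>

text \<open>The sentence is \<open>\<forall>ys \<exists>zs (\<phi>(ys,zs) \<and> X(zs))\<close>, and the arity of \<open>X\<close> is the length of \<open>zs\<close>.\<close>

definition sharp_Pi2_1VAR :: "vocabulary \<Rightarrow> ('a ordered_struct \<Rightarrow> nat) \<Rightarrow> bool" where
  "sharp_Pi2_1VAR \<sigma> B \<longleftrightarrow>
    (\<exists>ys zs \<phi>. distinct (ys @ zs) \<and> first_order_over \<sigma> \<phi> \<and> free_vars \<phi> \<subseteq> set (ys @ zs) \<and>
      (\<forall>A \<in> structures \<sigma>. B A =
        card {X. X \<subseteq> tuples (universe A) (length zs) \<and>
          models A X (foldr Forall ys (foldr Exists zs (Conj \<phi> (SOAtom (map Var zs)))))}))"


section \<open>Monotone CNF formulas\<close>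

datatype literal = PosLit nat | NegLit nat

type_synonym cnf = "literal list list"

fun lit_var :: "literal \<Rightarrow> nat" where
  "lit_var (PosLit v) = v"
| "lit_var (NegLit v) = v"

fun lit_true :: "nat set \<Rightarrow> literal \<Rightarrow> bool" where
  "lit_true T (PosLit v) = (v \<in> T)"
| "lit_true T (NegLit v) = (v \<notin> T)"

definition cnf_vars :: "cnf \<Rightarrow> nat set" where
  "cnf_vars F = (\<Union>c \<in> set F. lit_var ` set c)"

definition monotone_cnf :: "cnf \<Rightarrow> bool" where
  "monotone_cnf F \<longleftrightarrow> (\<forall>c \<in> set F. \<forall>l \<in> set c. \<exists>v. l = PosLit v)"

definition satisfies :: "nat set \<Rightarrow> cnf \<Rightarrow> bool" where
  "satisfies T F \<longleftrightarrow> (\<forall>c \<in> set F. \<exists>l \<in> set c. lit_true T l)"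

text \<open>An assignment is given by the set of true variables; it assigns values exactly to the
  variables that occur in the formula.\<close>

definition sharp_sat :: "cnf \<Rightarrow> nat" where
  "sharp_sat F = card {T. T \<subseteq> cnf_vars F \<and> satisfies T F}"

abbreviation sharp_MonotoneSat_instances :: "cnf set" where
  "sharp_MonotoneSat_instances \<equiv> {F. monotone_cnf F}"


section \<open>Multitape Turing machines and polynomial time\<close>

datatype move = MoveLeft | MoveRight | Stay

text \<open>States and tape symbols are initial segments of the natural numbers, state 0 is initial and
  symbol 0 is the blank, symbols 1 and 2 are the bits. The machine halts where \<open>delta\<close> is \<open>None\<close>.\<close>

record tmachine =
  tape_count :: nat
  symbol_count :: nat
  state_count :: nat
  delta :: "nat \<Rightarrow> nat list \<Rightarrow> (nat \<times> (nat \<times> move) list) option"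

definition wf_tmachine :: "tmachine \<Rightarrow> bool" where
  "wf_tmachine M \<longleftrightarrow> 1 \<le> tape_count M \<and> 3 \<le> symbol_count M \<and> 1 \<le> state_count M \<and>
    (\<forall>q ss q' acts.
      q < state_count M \<and> length ss = tape_count M \<and> set ss \<subseteq> {..<symbol_count M} \<and>
      delta M q ss = Some (q', acts) \<longrightarrow>
        q' < state_count M \<and> length acts = tape_count M \<and> fst ` set acts \<subseteq> {..<symbol_count M})"

text \<open>A tape is two-way infinite and comes with its head position.\<close>

type_synonym tape = "(int \<Rightarrow> nat) \<times> int"
type_synonym config = "nat \<times> tape list"

fun scan :: "tape \<Rightarrow> nat" where
  "scan (c, p) = c p"

fun shift :: "move \<Rightarrow> int \<Rightarrow> int" where
  "shift MoveLeft p = p - 1"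
| "shift MoveRight p = p + 1"
| "shift Stay p = p"

fun act :: "nat \<times> move \<Rightarrow> tape \<Rightarrow> tape" where
  "act (s, d) (c, p) = (c(p := s), shift d p)"

fun halted :: "tmachine \<Rightarrow> config \<Rightarrow> bool" where
  "halted M (q, ts) = (delta M q (map scan ts) = None)"

fun step :: "tmachine \<Rightarrow> config \<Rightarrow> config" where
  "step M (q, ts) =
    (case delta M q (map scan ts) of
       None \<Rightarrow> (q, ts)
     | Some (q', acts) \<Rightarrow> (q', map2 act acts ts))"

definition contents :: "bool list \<Rightarrow> int \<Rightarrow> nat" where
  "contents w i =
    (if 0 \<le> i \<and> i < int (length w) then (if w ! nat i then 2 else 1) else 0)"

definition initial :: "tmachine \<Rightarrow> bool list \<Rightarrow> config" where
  "initial M w = (0, (contents w, 0) # replicate (tape_count M - 1) (contents [], 0))"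

text \<open>The input is on the first tape and the output on the last one. Halted configurations are
  fixed by \<open>step\<close>, so that the following means halting after at most \<open>t\<close> steps.\<close>

definition outputs_within :: "tmachine \<Rightarrow> bool list \<Rightarrow> bool list \<Rightarrow> nat \<Rightarrow> bool" where
  "outputs_within M w v t \<longleftrightarrow>
    (let c = (step M ^^ t) (initial M w) in halted M c \<and> fst (last (snd c)) = contents v)"

text \<open>\<open>f\<close>, on the instances in \<open>D\<close>, is computable in polynomial time with respect to the encodings
  \<open>enc\<close> of its arguments and \<open>enc'\<close> of its values.\<close>

definition poly_time_computable ::
  "('x \<Rightarrow> bool list) \<Rightarrow> 'x set \<Rightarrow> ('y \<Rightarrow> bool list) \<Rightarrow> ('x \<Rightarrow> 'y) \<Rightarrow> bool" where
  "poly_time_computable enc D enc' f \<longleftrightarrow>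
    (\<exists>M (p :: nat poly). wf_tmachine M \<and>
      (\<forall>x \<in> D. outputs_within M (enc x) (enc' (f x)) (poly p (length (enc x)))))"


section \<open>Encodings\<close>

text \<open>Binary representation, most significant bit first; zero is the empty word.\<close>

fun enc_nat :: "nat \<Rightarrow> bool list" where
  "enc_nat n = (if n = 0 then [] else enc_nat (n div 2) @ [odd n])"

declare enc_nat.simps [simp del]

definition enumeration :: "'a ordered_struct \<Rightarrow> 'a list" where
  "enumeration A = (THE xs. set xs = universe A \<and> distinct xs \<and>
     sorted_wrt (\<lambda>a b. (a, b) \<in> less_eq_rel A) xs)"

lemma ex1_enumeration:
  assumes "A \<in> structures \<sigma>"
  shows "\<exists>!xs. set xs = universe A \<and> distinct xs \<and>
     sorted_wrt (\<lambda>a b. (a, b) \<in> less_eq_rel A) xs"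
proof -
  let ?r = "less_eq_rel A"
  let ?U = "universe A"
  have fin: "finite ?U" and lin: "linear_order_on ?U ?r"
    using assms by (auto simp: structures_def)
  have tr: "trans ?r" and anti: "antisym ?r" and tot: "total_on ?U ?r"
    using lin by (auto simp: order_on_defs)
  have ex: "\<exists>xs. set xs = S \<and> distinct xs \<and> sorted_wrt (\<lambda>a b. (a, b) \<in> ?r) xs"
    if "S \<subseteq> ?U" for S
    using finite_subset[OF that fin] that
  proof (induction S rule: finite_induct)
    case empty
    show ?case by (intro exI[of _ "[]"]) simp
  next
    case (insert x S)
    then obtain xs where xs: "set xs = S" "distinct xs" "sorted_wrt (\<lambda>a b. (a, b) \<in> ?r) xs"
      by auto
    let ?lo = "filter (\<lambda>y. (y, x) \<in> ?r) xs" and ?hi = "filter (\<lambda>y. (y, x) \<notin> ?r) xs"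
    have hi: "(x, y) \<in> ?r" if "y \<in> set ?hi" for y
      using that xs(1) insert.prems insert.hyps tot by (auto simp: total_on_def)
    have "sorted_wrt (\<lambda>a b. (a, b) \<in> ?r) (?lo @ x # ?hi)"
      using hi xs(3) by (auto simp: sorted_wrt_append sorted_wrt_filter intro: transD[OF tr])
    then show ?case
      using xs insert.hyps by (intro exI[of _ "?lo @ x # ?hi"]) auto
  qed
  have uniq: "xs = ys"
    if "set xs = set ys" "distinct xs" "distinct ys"
      "sorted_wrt (\<lambda>a b. (a, b) \<in> ?r) xs" "sorted_wrt (\<lambda>a b. (a, b) \<in> ?r) ys" for xs ys
    using that
  proof (induction xs arbitrary: ys)
    case Nil
    then show ?case by simp
  next
    case (Cons x xs)
    then obtain y ys' where ys: "ys = y # ys'" by (cases ys) auto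
    have "x = y"
    proof (rule ccontr)
      assume "x \<noteq> y"
      then have "(x, y) \<in> ?r" "(y, x) \<in> ?r" using Cons.prems ys by auto
      then show False using anti \<open>x \<noteq> y\<close> by (auto dest: antisymD)
    qed
    moreover have "set xs = set ys'" using Cons.prems ys \<open>x = y\<close> by auto
    ultimately show ?case using Cons ys by auto
  qed
  obtain xs where "set xs = ?U \<and> distinct xs \<and> sorted_wrt (\<lambda>a b. (a, b) \<in> ?r) xs"
    using ex[of ?U] by blast
  then show ?thesis using uniq by (intro ex1I[of _ xs]) auto
qed

text \<open>The size of the universe in unary, then the table of every relation, its tuples being in
  lexicographic order, then every constant as the table of a singleton. All positions refer to
  the increasing enumeration of the universe, which thereby encodes the order.\<close>

definition enc_struct :: "vocabulary \<Rightarrow> 'a ordered_struct \<Rightarrow> bool list" where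
  "enc_struct \<sigma> A = (let xs = enumeration A in
     replicate (length xs) True @ [False] @
     concat (map (\<lambda>(k, R). map (\<lambda>t. t \<in> R) (product_lists (replicate k xs)))
       (zip (rel_arities \<sigma>) (rel_vals A))) @
     concat (map (\<lambda>c. map (\<lambda>x. x = c) xs) (const_vals A)))"

text \<open>Words over an alphabet of four letters, each written with two bits: the doubled bits, and
  the end markers \<open>[False, True]\<close> of a literal and \<open>[True, False]\<close> of a clause. A literal is its sign
  followed by the index of its variable in binary.\<close>

definition double_bits :: "bool list \<Rightarrow> bool list" where
  "double_bits w = concat (map (\<lambda>b. [b, b]) w)"

fun enc_literal :: "literal \<Rightarrow> bool list" where
  "enc_literal (PosLit v) = double_bits (True # enc_nat v) @ [False, True]"
| "enc_literal (NegLit v) = double_bits (False # enc_nat v) @ [False, True]"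

definition enc_clause :: "literal list \<Rightarrow> bool list" where
  "enc_clause c = concat (map enc_literal c) @ [True, False]"

definition enc_cnf :: "cnf \<Rightarrow> bool list" where
  "enc_cnf F = concat (map enc_clause F)"


section \<open>Product reductions\<close>

text \<open>A counting problem is given by an encoding, its set of instances, and its counting function;
  the pair \<open>(h1, h2)\<close> reduces the problem \<open>f\<close> to the problem \<open>f'\<close>.\<close>

definition product_reduction ::
  "('x \<Rightarrow> bool list) \<Rightarrow> 'x set \<Rightarrow> ('x \<Rightarrow> nat) \<Rightarrow>
   ('y \<Rightarrow> bool list) \<Rightarrow> 'y set \<Rightarrow> ('y \<Rightarrow> nat) \<Rightarrow>
   ('x \<Rightarrow> 'y) \<Rightarrow> ('x \<Rightarrow> nat) \<Rightarrow> bool" where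
  "product_reduction enc D f enc' D' f' h1 h2 \<longleftrightarrow>
    poly_time_computable enc D enc' h1 \<and>
    poly_time_computable enc D enc_nat h2 \<and>
    (\<forall>x \<in> D. h1 x \<in> D' \<and> f x = f' (h1 x) * h2 x)"

end

theory Submission
  imports Defs
begin

text \<open>Introduce a variable for every tuple \<open>c\<close> that may or may not belong to \<open>X\<close>. The sentence then
  says that for every value \<open>b\<close> of the universal variables the clause of all \<open>c\<close> with \<open>\<phi>(b,c)\<close> is
  satisfied. This is a monotone CNF formula, but variables that occur in no clause contribute a
  power of two to the count. Adding to each clause a weaker copy that contains all variables makes
  every variable occur without changing the models, so that the factor \<open>h\<close> can be taken to be \<open>1\<close>.

  Polynomial time is shown with structured programs whose atomic actions write or move a single
  tape. The continuations of a program form a finite set, which serves as the set of states of a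
  Turing machine. The value of a first-order variable is kept on its own tape, as the one-hot
  string of its index in the increasing enumeration of the universe: a quantifier is then a loop
  that advances one tape, and a tuple is found in its table by nested skips over blocks of the
  input. The encoding of a constant in the input is already of this form.\<close>


section \<open>Structured programs on named tapes\<close>

text \<open>The counting argument is short; what shapes the development is that polynomial time
  means an explicit machine with an explicit polynomial. The sentence is fixed, so all loops are
  nested to a fixed depth, and the degree of the bound depends on the sentence and the vocabulary
  only. Bounds are polynomials in the length \<open>N\<close> of the input, chosen before the
  structure; the size \<open>n\<close> of the universe enters only through \<open>n \<le> N\<close>,
  which the unary header of the encoding guarantees. Programs are specified by exact stores: each
  larger routine puts back every head and counter that it moved, so that its whole effect is one
  update of the flag, of an index or of the output, and routines can be nested freely. No number is
  ever computed; heads count by moving along other tapes. On the side of the formula, the plain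
  clauses have to stay beside their padded copies. They alone carry the condition, and an empty one
  correctly forces the count to 0. Keeping the factor constant also avoids a second program that
  would have to find the number of absent variables.\<close>

datatype 'v prog =
    Nop
  | Wr 'v nat
  | Mv 'v move
  | Seq "'v prog" "'v prog" (infixr \<open>;;\<close> 60)
  | Cond 'v nat "'v prog" "'v prog"
  | Until 'v nat "'v prog"

fun prog_tapes :: "'v prog \<Rightarrow> 'v set" where
  "prog_tapes Nop = {}"
| "prog_tapes (Wr x a) = {x}"
| "prog_tapes (Mv x d) = {x}"
| "prog_tapes (p ;; q) = prog_tapes p \<union> prog_tapes q"
| "prog_tapes (Cond x a p q) = insert x (prog_tapes p \<union> prog_tapes q)"
| "prog_tapes (Until x a p) = insert x (prog_tapes p)"

text \<open>Only written symbols have to belong to the alphabet of three symbols; a test against a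
  larger number would merely never succeed.\<close>

fun ternary :: "'v prog \<Rightarrow> bool" where
  "ternary (Wr x a) = (a < 3)"
| "ternary (p ;; q) = (ternary p \<and> ternary q)"
| "ternary (Cond x a p q) = (ternary p \<and> ternary q)"
| "ternary (Until x a p) = ternary p"
| "ternary _ = True"

lemma finite_prog_tapes [simp]: "finite (prog_tapes p)"
  by (induction p) auto

text \<open>The control state is the list of programs that remain to be executed.\<close>

fun goto :: "'v prog list \<Rightarrow> ('v \<Rightarrow> nat) \<Rightarrow> 'v prog list" where
  "goto [] rd = []"
| "goto (Nop # K) rd = K"
| "goto (Wr x a # K) rd = K"
| "goto (Mv x d # K) rd = K"
| "goto ((p ;; q) # K) rd = p # q # K"
| "goto (Cond x a p q # K) rd = (if rd x = a then p else q) # K"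
| "goto (Until x a p # K) rd = (if rd x = a then K else p # Until x a p # K)"

fun actions :: "'v prog list \<Rightarrow> ('v \<Rightarrow> nat) \<Rightarrow> 'v \<Rightarrow> nat \<times> move" where
  "actions (Wr x a # K) rd = (\<lambda>v. (rd v, Stay))(x := (a, Stay))"
| "actions (Mv x d # K) rd = (\<lambda>v. (rd v, Stay))(x := (rd x, d))"
| "actions _ rd = (\<lambda>v. (rd v, Stay))"

type_synonym 'v store = "'v \<Rightarrow> tape"

fun prog_step :: "'v prog list \<times> 'v store \<Rightarrow> 'v prog list \<times> 'v store" where
  "prog_step (K, s) =
    (goto K (\<lambda>v. scan (s v)), \<lambda>v. act (actions K (\<lambda>v. scan (s v)) v) (s v))"

lemma act_scan [simp]: "act (scan t, Stay) t = t"
  by (cases t) auto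

lemma prog_step_simps [simp]:
  "prog_step ([], s) = ([], s)"
  "prog_step (Nop # K, s) = (K, s)"
  "prog_step (Wr x a # K, s) = (K, s(x := act (a, Stay) (s x)))"
  "prog_step (Mv x d # K, s) = (K, s(x := act (scan (s x), d) (s x)))"
  "prog_step ((p ;; q) # K, s) = (p # q # K, s)"
  "prog_step (Cond x a p q # K, s) = ((if scan (s x) = a then p else q) # K, s)"
  "prog_step (Until x a p # K, s) =
     (if scan (s x) = a then K else p # Until x a p # K, s)"
  by (auto simp: fun_eq_iff)

declare prog_step.simps [simp del]

text \<open>Quantifying over the continuation \<open>K\<close> makes the behaviour independent of
  the surrounding program, so that runs can be chained. The final store is exact while
  \<open>t\<close> is only an upper bound, which lets branches of different length share it.\<close>

definition runs :: "'v prog \<Rightarrow> 'v store \<Rightarrow> 'v store \<Rightarrow> nat \<Rightarrow> bool" where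
  "runs p s s' t \<longleftrightarrow> (\<forall>K. \<exists>t'\<le>t. (prog_step ^^ t') (p # K, s) = (K, s'))"

lemma runs_weaken: "runs p s s' t \<Longrightarrow> s' = s'' \<Longrightarrow> t \<le> t' \<Longrightarrow> runs p s s'' t'"
  unfolding runs_def using le_trans by blast

lemma runs_Nop: "1 \<le> t \<Longrightarrow> runs Nop s s t"
  unfolding runs_def by (intro allI exI[of _ 1]) simp

lemma runs_Wr: "runs (Wr x a) s (s(x := act (a, Stay) (s x))) 1"
  unfolding runs_def by (intro allI exI[of _ 1]) simp

lemma runs_Mv: "runs (Mv x d) s (s(x := act (scan (s x), d) (s x))) 1"
  unfolding runs_def by (intro allI exI[of _ 1]) simp

lemma steps_trans:
  "(prog_step ^^ a) c = c' \<Longrightarrow> (prog_step ^^ b) c' = c'' \<Longrightarrow> (prog_step ^^ (b + a)) c = c''"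
  by (simp add: funpow_add)

lemma runs_Seq:
  assumes "runs p s s1 t1" "runs q s1 s2 t2" "t1 + t2 + 1 \<le> t"
  shows "runs (p ;; q) s s2 t"
  unfolding runs_def
proof
  fix K
  obtain a where a: "a \<le> t1" "(prog_step ^^ a) (p # q # K, s) = (q # K, s1)"
    using assms(1) unfolding runs_def by blast
  obtain b where b: "b \<le> t2" "(prog_step ^^ b) (q # K, s1) = (K, s2)"
    using assms(2) unfolding runs_def by blast
  have "(prog_step ^^ Suc (b + a)) ((p ;; q) # K, s) = (K, s2)"
    using steps_trans[OF a(2) b(2)] by (simp add: funpow_Suc_right del: funpow.simps)
  then show "\<exists>t'\<le>t. (prog_step ^^ t') ((p ;; q) # K, s) = (K, s2)"
    using a(1) b(1) assms(3) by (intro exI[of _ "Suc (b + a)"]) auto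
qed

lemma runs_Cond:
  assumes "scan (s x) = a \<Longrightarrow> runs p s s' t" "scan (s x) \<noteq> a \<Longrightarrow> runs q s s' t" "t + 1 \<le> t'"
  shows "runs (Cond x a p q) s s' t'"
  unfolding runs_def
proof
  fix K
  let ?r = "if scan (s x) = a then p else q"
  have "runs ?r s s' t" using assms by auto
  then obtain b where b: "b \<le> t" "(prog_step ^^ b) (?r # K, s) = (K, s')"
    unfolding runs_def by blast
  have "(prog_step ^^ Suc b) (Cond x a p q # K, s) = (K, s')"
    using b(2) by (simp add: funpow_Suc_right del: funpow.simps)
  then show "\<exists>t''\<le>t'. (prog_step ^^ t'') (Cond x a p q # K, s) = (K, s')"
    using b(1) assms(3) by (intro exI[of _ "Suc b"]) auto
qed

text \<open>\<open>S\<close> is the loop invariant in functional form: \<open>S i\<close> is the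
  exact store after \<open>i\<close> rounds. A round costs its body and one test; the summand
  \<open>1\<close> is the test that leaves the loop.\<close>

lemma runs_Until:
  assumes "\<And>i. i < k \<Longrightarrow> scan (S i x) \<noteq> a"
    and "\<And>i. i < k \<Longrightarrow> runs p (S i) (S (Suc i)) t"
    and "scan (S k x) = a" "k * (t + 1) + 1 \<le> t'"
  shows "runs (Until x a p) (S 0) (S k) t'"
proof -
  have "\<exists>b \<le> i * (t + 1). (prog_step ^^ b) (Until x a p # K, S 0) = (Until x a p # K, S i)"
    if "i \<le> k" for i K
    using that
  proof (induction i)
    case 0
    show ?case by simp
  next
    case (Suc i)
    then obtain b where b: "b \<le> i * (t + 1)"
      "(prog_step ^^ b) (Until x a p # K, S 0) = (Until x a p # K, S i)" by auto
    obtain c where c: "c \<le> t"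
      "(prog_step ^^ c) (p # Until x a p # K, S i) = (Until x a p # K, S (Suc i))"
      using assms(2)[of i] Suc.prems unfolding runs_def by force
    have "(prog_step ^^ Suc c) (Until x a p # K, S i) = (Until x a p # K, S (Suc i))"
      using c(2) assms(1)[of i] Suc.prems by (simp add: funpow_Suc_right del: funpow.simps)
    from steps_trans[OF b(2) this] show ?case
      using b(1) c(1) by (intro exI[of _ "Suc c + b"]) auto
  qed
  note loop = this[OF order_refl]
  show ?thesis
    unfolding runs_def
  proof
    fix K
    obtain b where b: "b \<le> k * (t + 1)"
      "(prog_step ^^ b) (Until x a p # K, S 0) = (Until x a p # K, S k)" using loop by blast
    have "(prog_step ^^ Suc b) (Until x a p # K, S 0) = (K, S k)"
      using b(2) assms(3) by simp
    then show "\<exists>b\<le>t'. (prog_step ^^ b) (Until x a p # K, S 0) = (K, S k)"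
      using b(1) assms(4) by (intro exI[of _ "Suc b"]) auto
  qed
qed


section \<open>Turing machines from programs\<close>

text \<open>Contains the control states met before \<open>K\<close> is reached; \<open>K\<close>
  itself belongs to the surrounding program. The set is finite because a loop body is followed on
  the list by the loop itself and not by its unrollings.\<close>

fun continuations :: "'v prog \<Rightarrow> 'v prog list \<Rightarrow> 'v prog list set" where
  "continuations (p ;; q) K =
     insert ((p ;; q) # K) (continuations p (q # K) \<union> continuations q K)"
| "continuations (Cond x a p q) K =
     insert (Cond x a p q # K) (continuations p K \<union> continuations q K)"
| "continuations (Until x a p) K =
     insert (Until x a p # K) (continuations p (Until x a p # K))"
| "continuations p K = {p # K}"

lemma finite_continuations: "finite (continuations p K)"
  by (induction p arbitrary: K) auto

lemma self_in_continuations: "p # K \<in> continuations p K"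
  by (cases p) auto

lemma goto_continuations:
  "L \<in> continuations p K \<Longrightarrow> goto L rd \<in> insert K (continuations p K)"
proof (induction p arbitrary: K)
  case (Seq p q)
  from Seq.prems consider "L = (p ;; q) # K" | "L \<in> continuations p (q # K)"
    | "L \<in> continuations q K" by auto
  then show ?case
  proof cases
    case 1
    then show ?thesis using self_in_continuations[of p "q # K"] by simp
  next
    case 2
    show ?thesis using Seq.IH(1)[OF 2] self_in_continuations[of q K] by auto
  next
    case 3
    show ?thesis using Seq.IH(2)[OF 3] by auto
  qed
next
  case (Cond x a p q)
  then show ?case using self_in_continuations[of p K] self_in_continuations[of q K] by auto
next
  case (Until x a p)
  then show ?case
    using Until.IH[of "Until x a p # K"] self_in_continuations[of p "Until x a p # K"]
    by (auto split: if_splits)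
qed auto

text \<open>The transition table needs these restrictions at every control state: they keep the
  written symbols in the alphabet and make each transition depend only on tapes that the machine
  has.\<close>

lemma continuations_invariant:
  assumes "L \<in> continuations p K" "prog_tapes p \<subseteq> V" "ternary p"
    "\<forall>q \<in> set K. prog_tapes q \<subseteq> V \<and> ternary q"
  shows "\<forall>q \<in> set L. prog_tapes q \<subseteq> V \<and> ternary q"
  using assms
proof (induction p arbitrary: K)
  case (Seq p q)
  from Seq.prems(1) consider "L = (p ;; q) # K" | "L \<in> continuations p (q # K)"
    | "L \<in> continuations q K" by auto
  then show ?case
  proof cases
    case 1
    then show ?thesis using Seq.prems(2-4) by simp
  next
    case 2
    show ?thesis by (rule Seq.IH(1)[OF 2]; use Seq.prems(2-4) in simp)
  next
    case 3
    show ?thesis by (rule Seq.IH(2)[OF 3]; use Seq.prems(2-4) in simp)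
  qed
next
  case (Cond x a p q)
  from Cond.prems(1) consider "L = Cond x a p q # K" | "L \<in> continuations p K"
    | "L \<in> continuations q K" by auto
  then show ?case
  proof cases
    case 1
    then show ?thesis using Cond.prems(2-4) by simp
  next
    case 2
    show ?thesis by (rule Cond.IH(1)[OF 2]; use Cond.prems(2-4) in simp)
  next
    case 3
    show ?thesis by (rule Cond.IH(2)[OF 3]; use Cond.prems(2-4) in simp)
  qed
next
  case (Until x a p)
  from Until.prems(1) consider "L = Until x a p # K" | "L \<in> continuations p (Until x a p # K)"
    by auto
  then show ?case
  proof cases
    case 1
    then show ?thesis using Until.prems(2-4) by simp
  next
    case 2
    show ?thesis by (rule Until.IH[OF 2]; use Until.prems(2-4) in simp)
  qed
qed auto

lemma goto_cong:
  assumes "\<forall>q \<in> set K. prog_tapes q \<subseteq> V" "\<And>v. v \<in> V \<Longrightarrow> rd v = rd' v"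
  shows "goto K rd = goto K rd'"
proof (cases K)
  case (Cons p L)
  then show ?thesis using assms by (cases p) auto
qed simp

lemma actions_cong:
  assumes "rd v = rd' v"
  shows "actions K rd v = actions K rd' v"
proof (cases K)
  case (Cons p L)
  then show ?thesis using assms by (cases p) auto
qed (use assms in simp)

lemma actions_symbol:
  assumes "\<forall>q \<in> set K. ternary q" "rd v < 3"
  shows "fst (actions K rd v) < 3"
proof (cases K)
  case (Cons p L)
  then show ?thesis using assms by (cases p) auto
qed (use assms in simp)

theorem program_machine:
  fixes p :: "'v prog" and names :: "'v list"
  assumes dist: "distinct names" and ne: "names \<noteq> []"
    and tapes: "prog_tapes p \<subseteq> set names" and tern: "ternary p"
  obtains M where "wf_tmachine M" "tape_count M = length names"
    "\<And>s s' t. runs p s s' t \<Longrightarrow>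
       halted M ((step M ^^ t) (0, map s names)) \<and>
       snd ((step M ^^ t) (0, map s names)) = map s' names"
proof -
  define Q where "Q = insert [] (continuations p [])"
  have "finite Q" by (simp add: Q_def finite_continuations)
  then obtain qs' where qs': "set qs' = Q - {[p]}" "distinct qs'"
    using finite_distinct_list[of "Q - {[p]}"] by blast
  \<comment> \<open>Machines start in state 0, so \<open>[p]\<close> must come first in the
    enumeration of the states.\<close>
  define qs where "qs = [p] # qs'"
  have qs: "set qs = Q" "distinct qs" "qs ! 0 = [p]"
    using qs' self_in_continuations[of p "[]"] by (auto simp: qs_def Q_def)
  have inQ: "[p] \<in> Q" "[] \<in> Q" using self_in_continuations[of p "[]"] by (auto simp: Q_def)
  have gotoQ: "goto K rd \<in> Q" if "K \<in> Q" for K rd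
    using that goto_continuations[of K p "[]" rd] by (auto simp: Q_def)
  have invQ: "\<forall>q \<in> set K. prog_tapes q \<subseteq> set names \<and> ternary q" if "K \<in> Q" for K
    using that continuations_invariant[of K p "[]" "set names"] tapes tern by (auto simp: Q_def)
  define idx where "idx = inv_into {..<length qs} ((!) qs)"
  have inj: "inj_on ((!) qs) {..<length qs}" using qs(2) by (simp add: inj_on_nth)
  have img: "(!) qs ` {..<length qs} = Q" using qs(1) by (auto simp: set_conv_nth)
  have idx: "idx K < length qs" "qs ! idx K = K" if "K \<in> Q" for K
    using that inv_into_into[of K "(!) qs" "{..<length qs}"]
      f_inv_into_f[of K "(!) qs" "{..<length qs}"] img by (auto simp: idx_def)
  have idx0: "idx [p] = 0"
    using inv_into_f_f[OF inj, of 0] qs(3) by (simp add: idx_def qs_def)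
  \<comment> \<open>A transition sees a bare list of symbols; this turns it into a reading of named
    tapes. The default 0 is for names without a tape.\<close>
  define rd :: "nat list \<Rightarrow> 'v \<Rightarrow> nat"
    where "rd ss v = (case map_of (zip names ss) v of Some a \<Rightarrow> a | None \<Rightarrow> 0)" for ss v
  have rd_map: "rd (map f names) v = f v" if "v \<in> set names" for f v
    using that by (simp add: rd_def map_of_zip_map)
  have rd_less: "rd ss v < 3" if "length ss = length names" "set ss \<subseteq> {..<3}" for ss v
  proof (cases "map_of (zip names ss) v")
    case (Some a)
    then have "a \<in> set ss" using map_of_SomeD set_zip_rightD by metis
    then show ?thesis using Some that by (auto simp: rd_def)
  qed (simp add: rd_def)
  define M where "M = \<lparr>tape_count = length names, symbol_count = 3, state_count = length qs,
    delta = (\<lambda>q ss. if qs ! q = [] then None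
      else Some (idx (goto (qs ! q) (rd ss)), map (actions (qs ! q) (rd ss)) names))\<rparr>"
  have wf: "wf_tmachine M"
  proof -
    have "1 \<le> length names" using ne by (cases names) auto
    moreover have "q' < length qs \<and> length acts = length names \<and> fst ` set acts \<subseteq> {..<3}"
      if q: "q < length qs" and ss: "length ss = length names" "set ss \<subseteq> {..<3}"
        and d: "delta M q ss = Some (q', acts)" for q ss q' acts
    proof -
      have K: "qs ! q \<in> Q" using q qs(1) by auto
      have q': "q' = idx (goto (qs ! q) (rd ss))"
        and acts: "acts = map (actions (qs ! q) (rd ss)) names"
        using d by (auto simp: M_def split: if_splits)
      have "fst (actions (qs ! q) (rd ss) v) < 3" for v
        using actions_symbol[of "qs ! q" "rd ss" v] invQ[OF K] rd_less[OF ss] by blast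
      then show ?thesis using idx(1)[OF gotoQ[OF K]] q' acts by auto
    qed
    ultimately show ?thesis
      unfolding wf_tmachine_def
      by (intro conjI allI impI; (elim conjE)?) (simp_all add: M_def qs_def)
  qed
  have sim: "step M (idx K, map s names) =
      (idx (fst (prog_step (K, s))), map (snd (prog_step (K, s))) names)" if K: "K \<in> Q" for K s
  proof (cases "K = []")
    case True
    then show ?thesis using idx(2)[OF K] by (simp add: M_def)
  next
    case False
    let ?r = "rd (map scan (map s names))"
    have r: "?r v = scan (s v)" if "v \<in> set names" for v
      using rd_map[OF that, of "\<lambda>v. scan (s v)"] by (simp add: comp_def)
    have "goto K ?r = goto K (\<lambda>v. scan (s v))"
      by (rule goto_cong[of K "set names"]) (use invQ[OF K] r in auto)
    moreover have "actions K ?r v = actions K (\<lambda>v. scan (s v)) v" if "v \<in> set names" for v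
      using actions_cong[of ?r v "\<lambda>v. scan (s v)" K] r[OF that] by simp
    ultimately show ?thesis
      using False idx(2)[OF K] by (simp add: M_def prog_step.simps map2_map_map)
  qed
  have stepQ: "fst (prog_step (K, s)) \<in> Q" if "K \<in> Q" for K s
    using gotoQ[OF that] by (simp add: prog_step.simps)
  have sims: "fst ((prog_step ^^ t) ([p], s)) \<in> Q \<and> (step M ^^ t) (0, map s names) =
      (idx (fst ((prog_step ^^ t) ([p], s))), map (snd ((prog_step ^^ t) ([p], s))) names)" for t s
  proof (induction t)
    case 0
    then show ?case using idx0 inQ by simp
  next
    case (Suc t)
    obtain K s' where Ks: "(prog_step ^^ t) ([p], s) = (K, s')" by fastforce
    then show ?case using Suc sim[of K s'] stepQ[of K s'] by simp
  qed
  have "halted M ((step M ^^ t) (0, map s names)) \<and>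
       snd ((step M ^^ t) (0, map s names)) = map s' names" if R: "runs p s s' t" for s s' t
  proof -
    obtain a where a: "a \<le> t" "(prog_step ^^ a) ([p], s) = ([], s')"
      using R unfolding runs_def by blast
    \<comment> \<open>The program may finish before time \<open>t\<close>. The empty continuation is
      a fixed point, so the remaining steps idle, and its index is the halting state.\<close>
    have fix0: "(prog_step ^^ b) ([], s') = ([], s')" for b by (induction b) auto
    have "(prog_step ^^ (t - a + a)) ([p], s) = ([], s')"
      using steps_trans[OF a(2) fix0[of "t - a"]] .
    then show ?thesis using a(1) sims[of t s] idx(2)[OF inQ(2)] by (simp add: M_def)
  qed
  then show thesis using that[of M] wf by (auto simp: M_def)
qed

text \<open>The order of the names fixes their roles: input on the first tape, output on the last
  one. Outside \<open>x # names\<close> the store \<open>s\<close> may be chosen at will, a freedom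
  that the initialization exploits.\<close>

theorem poly_time_computable_program:
  fixes p :: "'v prog" and names :: "'v list"
  assumes "distinct (x # names)" "names \<noteq> []"
    "prog_tapes p \<subseteq> set (x # names)" "ternary p"
    and "\<exists>q. \<forall>a \<in> D. \<exists>s s'. runs p s s' (poly q (length (enc a))) \<and>
      s x = (contents (enc a), 0) \<and> (\<forall>v \<in> set names. s v = (contents [], 0)) \<and>
      fst (s' (last names)) = contents (enc' (f a))"
  shows "poly_time_computable enc D enc' f"
proof -
  obtain M where M: "wf_tmachine M" "tape_count M = length (x # names)"
    "\<And>s s' t. runs p s s' t \<Longrightarrow>
       halted M ((step M ^^ t) (0, map s (x # names))) \<and>
       snd ((step M ^^ t) (0, map s (x # names))) = map s' (x # names)"
    using program_machine[of "x # names" p] assms(1,3,4) by blast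
  obtain q where q: "\<forall>a \<in> D. \<exists>s s'. runs p s s' (poly q (length (enc a))) \<and>
      s x = (contents (enc a), 0) \<and> (\<forall>v \<in> set names. s v = (contents [], 0)) \<and>
      fst (s' (last names)) = contents (enc' (f a))"
    using assms(5) by blast
  have "outputs_within M (enc a) (enc' (f a)) (poly q (length (enc a)))" if a: "a \<in> D" for a
  proof -
    obtain s s' where s: "runs p s s' (poly q (length (enc a)))"
      "s x = (contents (enc a), 0)" "\<forall>v \<in> set names. s v = (contents [], 0)"
      "fst (s' (last names)) = contents (enc' (f a))" using q a by blast
    have "map s names = replicate (length names) (contents [], 0)"
      using s(3) by (simp add: map_replicate_const[symmetric] cong: map_cong)
    then have "initial M (enc a) = (0, map s (x # names))"
      using s(2) M(2) by (simp add: initial_def)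
    moreover have "last (map s' (x # names)) = s' (last names)"
      using assms(2) by (simp add: last_map)
    ultimately show ?thesis
      using M(3)[OF s(1)] s(4) by (simp add: outputs_within_def Let_def)
  qed
  then show ?thesis unfolding poly_time_computable_def using M(1) by blast
qed


section \<open>Tapes holding bit strings\<close>

definition bit_sym :: "bool \<Rightarrow> nat" where
  "bit_sym b = (if b then 2 else 1)"

lemma bit_sym_simps [simp]: "bit_sym b = bit_sym b' \<longleftrightarrow> b = b'" "bit_sym b \<noteq> 0" "0 \<noteq> bit_sym b" "bit_sym b < 3"
  by (auto simp: bit_sym_def)

definition bits_tape :: "bool list \<Rightarrow> nat \<Rightarrow> tape" where
  "bits_tape w p = (contents w, int p)"

lemma scan_bits_tape: "scan (bits_tape w p) = (if p < length w then bit_sym (w ! p) else 0)"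
  by (auto simp: bits_tape_def contents_def bit_sym_def)

lemma runs_right:
  assumes "s x = bits_tape w p"
  shows "runs (Mv x MoveRight) s (s(x := bits_tape w (Suc p))) 1"
  by (rule runs_weaken[OF runs_Mv]) (use assms in \<open>auto simp: bits_tape_def fun_eq_iff\<close>)

lemma contents_update:
  assumes "p < length w"
  shows "(contents w)(int p := bit_sym b) = contents (w[p := b])"
  using assms by (auto simp: contents_def bit_sym_def fun_eq_iff nth_list_update)

lemma contents_snoc: "(contents w)(int (length w) := bit_sym b) = contents (w @ [b])"
  by (auto simp: contents_def bit_sym_def fun_eq_iff nth_append)

lemma runs_write:
  assumes "s x = bits_tape w p" "p < length w"
  shows "runs (Wr x (bit_sym b)) s (s(x := bits_tape (w[p := b]) p)) 1"
  by (rule runs_weaken[OF runs_Wr]) (use assms in \<open>auto simp: bits_tape_def contents_update\<close>)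

lemma runs_write_end:
  assumes "s x = bits_tape w (length w)"
  shows "runs (Wr x (bit_sym b)) s (s(x := bits_tape (w @ [b]) (length w))) 1"
  by (rule runs_weaken[OF runs_Wr]) (use assms in \<open>auto simp: bits_tape_def contents_snoc\<close>)

definition emit :: "'v \<Rightarrow> bool \<Rightarrow> 'v prog" where
  "emit x b = Wr x (bit_sym b) ;; Mv x MoveRight"

lemma runs_emit:
  assumes "s x = bits_tape w (length w)"
  shows "runs (emit x b) s (s(x := bits_tape (w @ [b]) (length (w @ [b])))) 3"
proof -
  let ?s = "s(x := bits_tape (w @ [b]) (length w))"
  have "runs (Mv x MoveRight) ?s (?s(x := bits_tape (w @ [b]) (Suc (length w)))) 1"
    by (rule runs_right) simp
  from runs_Seq[OF runs_write_end[of s x w b] this, of 3] show ?thesis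
    using assms by (simp add: emit_def)
qed

text \<open>The first move takes the head off the blank behind the string, where it may stand; the
  loop then stops at the blank in cell -1.\<close>

definition rewind :: "'v \<Rightarrow> 'v prog" where
  "rewind x = Mv x MoveLeft ;; Until x 0 (Mv x MoveLeft) ;; Mv x MoveRight"

lemma runs_rewind:
  assumes "s x = bits_tape w p" "p \<le> length w" "2 * p + 5 \<le> t"
  shows "runs (rewind x) s (s(x := bits_tape w 0)) t"
proof -
  define S where "S i = s(x := (contents w, int p - 1 - int i))" for i
  have 1: "runs (Mv x MoveLeft) s (S 0) 1"
    by (rule runs_weaken[OF runs_Mv])
       (use assms in \<open>auto simp: S_def bits_tape_def fun_eq_iff\<close>)
  have 2: "runs (Until x 0 (Mv x MoveLeft)) (S 0) (S p) (p * 2 + 1)"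
  proof (rule runs_Until[where t = 1])
    fix i assume i: "i < p"
    then have "nat (int p - 1 - int i) < length w" using assms(2) by linarith
    then show "scan (S i x) \<noteq> 0" using i assms(2) by (auto simp: S_def contents_def)
    show "runs (Mv x MoveLeft) (S i) (S (Suc i)) 1"
      by (rule runs_weaken[OF runs_Mv]) (auto simp: S_def)
  qed (auto simp: S_def contents_def)
  have 3: "runs (Mv x MoveRight) (S p) (s(x := bits_tape w 0)) 1"
    by (rule runs_weaken[OF runs_Mv]) (auto simp: S_def bits_tape_def)
  show ?thesis
    unfolding rewind_def using assms(3) by (intro runs_Seq[OF 1 runs_Seq[OF 2 3 order_refl]]) simp
qed

section \<open>Loops over the cells of a tape and over indices\<close>

definition sweep :: "'v \<Rightarrow> nat \<Rightarrow> 'v prog \<Rightarrow> 'v prog" where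
  "sweep x a p = Until x a (p ;; Mv x MoveRight) ;; rewind x"

text \<open>The entry of \<open>S j\<close> at \<open>x\<close> is overwritten throughout, so the
  invariant does not have to follow the swept head; in return the body must preserve tape
  \<open>x\<close>. Rewinding adds 2 steps per round to the \<open>t + 3\<close> of the loop. The
  bound \<open>N\<close> replaces the number \<open>k\<close> of rounds so that time can later be
  measured by the length of the input.\<close>

lemma runs_sweep:
  assumes body: "\<And>j. j < k \<Longrightarrow>
      runs p ((S j)(x := bits_tape w j)) ((S (Suc j))(x := bits_tape w j)) t"
    and cells: "\<And>j. j < k \<Longrightarrow> scan (bits_tape w j) \<noteq> a" "scan (bits_tape w k) = a" "k \<le> length w"
    and ends: "s = (S 0)(x := bits_tape w 0)" "s' = (S k)(x := bits_tape w 0)"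
    and time: "k \<le> N" "N * (t + 5) + 7 \<le> t'"
  shows "runs (sweep x a p) s s' t'"
proof -
  define T where "T j = (S j)(x := bits_tape w j)" for j
  have 1: "runs (Until x a (p ;; Mv x MoveRight)) (T 0) (T k) (k * (t + 3) + 1)"
  proof (rule runs_Until[where t = "t + 2"])
    fix j assume j: "j < k"
    then show "scan (T j x) \<noteq> a" using cells by (simp add: T_def)
    let ?s = "(S (Suc j))(x := bits_tape w j)"
    have "runs (Mv x MoveRight) ?s (T (Suc j)) 1"
      by (rule runs_weaken[OF runs_right]) (auto simp: T_def)
    then show "runs (p ;; Mv x MoveRight) (T j) (T (Suc j)) (t + 2)"
      unfolding T_def by (intro runs_Seq[OF body[OF j]]) auto
  qed (use cells in \<open>auto simp: T_def algebra_simps\<close>)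
  have "runs (rewind x) (T k) ((T k)(x := bits_tape w 0)) (2 * k + 5)"
    by (rule runs_rewind) (use cells in \<open>auto simp: T_def\<close>)
  then have 2: "runs (rewind x) (T k) s' (2 * k + 5)" by (simp add: T_def ends)
  have "k * (t + 5) \<le> N * (t + 5)" using time(1) by (rule mult_le_mono1)
  then have "k * (t + 3) + 1 + (2 * k + 5) + 1 \<le> t'" using time(2) by (simp add: algebra_simps)
  from runs_Seq[OF 1 2 this] show ?thesis by (simp add: sweep_def T_def ends)
qed

text \<open>For \<open>i \<ge> n\<close> no bit is set; \<open>one_hot n n\<close> is the form of an
  exhausted counter.\<close>

definition one_hot :: "nat \<Rightarrow> nat \<Rightarrow> bool list" where
  "one_hot n i = map (\<lambda>j. j = i) [0..<n]"

lemma length_one_hot [simp]: "length (one_hot n i) = n"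
  by (simp add: one_hot_def)

lemma one_hot_neq_Nil [simp]: "0 < n \<Longrightarrow> [] \<noteq> one_hot n i"
  by (metis length_one_hot list.size(3) less_irrefl)

lemma one_hot_nth [simp]: "j < n \<Longrightarrow> one_hot n i ! j = (j = i)"
  by (simp add: one_hot_def)

definition index_tape :: "nat \<Rightarrow> nat \<Rightarrow> tape" where
  "index_tape n i = bits_tape (one_hot n i) 0"

text \<open>The sweep stops at the only set bit, so the body runs exactly \<open>i\<close> times: an
  index acts as a loop count without being decoded.\<close>

lemma runs_sweep_below:
  assumes "\<And>j. j < i \<Longrightarrow> runs p ((S j)(x := bits_tape (one_hot n i) j))
      ((S (Suc j))(x := bits_tape (one_hot n i) j)) t"
    and "i < n" "s = (S 0)(x := index_tape n i)" "s' = (S i)(x := index_tape n i)"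
      "n \<le> N" "N * (t + 5) + 7 \<le> t'"
  shows "runs (sweep x (bit_sym True) p) s s' t'"
  by (rule runs_sweep[where S = S and w = "one_hot n i" and k = i, OF assms(1)])
     (use assms(2-) in \<open>auto simp: index_tape_def scan_bits_tape\<close>)

lemma runs_sweep_all:
  assumes "\<And>j. j < n \<Longrightarrow> runs p ((S j)(x := bits_tape w j)) ((S (Suc j))(x := bits_tape w j)) t"
    and "length w = n" "s = (S 0)(x := bits_tape w 0)" "s' = (S n)(x := bits_tape w 0)"
      "n \<le> N" "N * (t + 5) + 7 \<le> t'"
  shows "runs (sweep x 0 p) s s' t'"
  by (rule runs_sweep[where S = S and w = w and k = n, OF assms(1)])
     (use assms(2-) in \<open>auto simp: scan_bits_tape\<close>)

text \<open>If the mark would leave the string, the tape stays cleared with its head on the blank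
  behind it. This blank is the exit condition of \<open>for_each\<close>.\<close>

definition advance :: "'v \<Rightarrow> 'v prog" where
  "advance x = Until x (bit_sym True) (Mv x MoveRight) ;; Wr x (bit_sym False) ;; Mv x MoveRight ;;
     Cond x 0 Nop (Wr x (bit_sym True) ;; rewind x)"

lemma one_hot_clear: "i < n \<Longrightarrow> (one_hot n i)[i := False] = one_hot n n"
  by (auto intro!: nth_equalityI simp: nth_list_update split: if_splits)

lemma one_hot_set: "i < n \<Longrightarrow> (one_hot n n)[i := True] = one_hot n i"
  by (auto intro!: nth_equalityI simp: nth_list_update split: if_splits)

lemma runs_advance:
  assumes "s x = index_tape n i" "i < n"
  shows "runs (advance x) s
    (s(x := if Suc i < n then index_tape n (Suc i) else bits_tape (one_hot n n) n)) (4 * n + 20)"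
    (is "runs _ _ ?s' _")
proof -
  let ?w = "one_hot n n"
  have 1: "runs (Until x (bit_sym True) (Mv x MoveRight)) s (s(x := bits_tape (one_hot n i) i)) (2 * n + 1)"
  proof -
    let ?S = "\<lambda>j. s(x := bits_tape (one_hot n i) j)"
    have "runs (Until x (bit_sym True) (Mv x MoveRight)) (?S 0) (?S i) (2 * n + 1)"
    proof (rule runs_Until[where t = 1])
      fix j assume "j < i"
      then show "scan (?S j x) \<noteq> bit_sym True" using assms(2) by (simp add: scan_bits_tape)
      show "runs (Mv x MoveRight) (?S j) (?S (Suc j)) 1"
        by (rule runs_weaken[OF runs_right]) auto
    qed (use assms(2) in \<open>auto simp: scan_bits_tape\<close>)
    moreover have "?S 0 = s" using assms(1) by (simp add: index_tape_def fun_upd_idem)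
    ultimately show ?thesis by simp
  qed
  have 2: "runs (Wr x (bit_sym False)) (s(x := bits_tape (one_hot n i) i)) (s(x := bits_tape ?w i)) 1"
    by (rule runs_weaken[OF runs_write]) (use assms(2) one_hot_clear[of i n] in auto)
  have 3: "runs (Mv x MoveRight) (s(x := bits_tape ?w i)) (s(x := bits_tape ?w (Suc i))) 1"
    by (rule runs_weaken[OF runs_right]) auto
  have 4: "runs (Cond x 0 Nop (Wr x (bit_sym True) ;; rewind x)) (s(x := bits_tape ?w (Suc i))) ?s'
      (2 * n + 8)"
  proof (cases "Suc i < n")
    case True
    have a: "runs (Wr x (bit_sym True)) (s(x := bits_tape ?w (Suc i)))
        (s(x := bits_tape (one_hot n (Suc i)) (Suc i))) 1"
      by (rule runs_weaken[OF runs_write]) (use True one_hot_set[of "Suc i" n] in auto)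
    have b: "runs (rewind x) (s(x := bits_tape (one_hot n (Suc i)) (Suc i)))
        (s(x := index_tape n (Suc i))) (2 * n + 5)"
      by (rule runs_weaken[OF runs_rewind[OF _ _ order_refl]]) (use True in \<open>auto simp: index_tape_def\<close>)
    show ?thesis
      by (rule runs_Cond[where t = "2 * n + 7"])
         (use True runs_Seq[OF a b] in \<open>auto simp: scan_bits_tape\<close>)
  next
    case False
    then have "n = Suc i" using assms(2) by simp
    then show ?thesis
      by (intro runs_Cond[where t = "2 * n + 7"]) (auto simp: scan_bits_tape intro: runs_Nop)
  qed
  show ?thesis
    unfolding advance_def
    by (rule runs_Seq[OF 1 runs_Seq[OF 2 runs_Seq[OF 3 4 order_refl] order_refl]]) simp
qed

text \<open>Setting bit 0 at the end turns the exhausted counter back into index 0. The loop leaves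
  its tape as it found it and can therefore be the body of another loop.\<close>

definition for_each :: "'v \<Rightarrow> 'v prog \<Rightarrow> 'v prog" where
  "for_each x p = Until x 0 (p ;; advance x) ;; rewind x ;; Wr x (bit_sym True)"

lemma runs_for_each:
  assumes body: "\<And>i. i < n \<Longrightarrow>
      runs p ((S i)(x := index_tape n i)) ((S (Suc i))(x := index_tape n i)) t"
    and ends: "s = (S 0)(x := index_tape n 0)" "s' = (S n)(x := index_tape n 0)"
    and n: "0 < n" "n \<le> N" and time: "N * (t + 4 * N + 30) + 20 \<le> t'"
  shows "runs (for_each x p) s s' t'"
proof -
  define T where
    "T i = (S i)(x := if i < n then index_tape n i else bits_tape (one_hot n n) n)" for i
  have 1: "runs (Until x 0 (p ;; advance x)) (T 0) (T n) (n * (t + 4 * n + 22) + 1)"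
  proof (rule runs_Until[where t = "t + 4 * n + 21"])
    fix i assume i: "i < n"
    then show "scan (T i x) \<noteq> 0" by (simp add: T_def index_tape_def scan_bits_tape)
    let ?s = "(S (Suc i))(x := index_tape n i)"
    have "runs (advance x) ?s (T (Suc i)) (4 * n + 20)"
      by (rule runs_weaken[OF runs_advance]) (use i in \<open>auto simp: T_def\<close>)
    then show "runs (p ;; advance x) (T i) (T (Suc i)) (t + 4 * n + 21)"
      using runs_Seq[OF body[OF i]] i by (simp add: T_def)
  qed (auto simp: T_def scan_bits_tape)
  have 2: "runs (rewind x) (T n) ((T n)(x := bits_tape (one_hot n n) 0)) (2 * n + 5)"
    by (rule runs_rewind) (auto simp: T_def)
  have 3: "runs (Wr x (bit_sym True)) ((T n)(x := bits_tape (one_hot n n) 0)) s' 1"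
    by (rule runs_weaken[OF runs_write])
       (use n one_hot_set[of 0 n] in \<open>auto simp: T_def ends index_tape_def\<close>)
  have "n * (t + 4 * n + 30) \<le> N * (t + 4 * N + 30)" using n(2) by (intro mult_le_mono) auto
  then have le: "n * (t + 4 * n + 22) + 1 + (2 * n + 5 + 1 + 1) + 1 \<le> t'"
    using time by (simp add: algebra_simps)
  have "T 0 = s" using n by (simp add: T_def ends)
  then show ?thesis
    using runs_Seq[OF 1 runs_Seq[OF 2 3 order_refl] le] by (simp add: for_each_def)
qed


section \<open>Looking up the input\<close>

text \<open>\<open>FlagT\<close> carries the result of the latest test. Once filled, the tapes
  \<open>LoopT j\<close> are only moved along, never rewritten: they are rulers as long as the
  universe is large.\<close>

datatype tape_name = InT | FlagT | LoopT nat | ConstT nat | VarT nat | OutT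

fun skip :: "nat \<Rightarrow> tape_name prog" where
  "skip 0 = Mv InT MoveRight"
| "skip (Suc m) = sweep (LoopT m) 0 (skip m)"

lemma runs_skip:
  "\<exists>q. \<forall>N n s w p. n \<le> N \<and> (\<forall>j. s (LoopT j) = index_tape n 0) \<and> s InT = bits_tape w p \<longrightarrow>
    runs (skip m) s (s(InT := bits_tape w (p + n ^ m))) (poly q N)"
proof -
  \<comment> \<open>The induction may only speak of the rulers below \<open>m\<close>. While the
    inner skip runs, the head of ruler \<open>m\<close> is in the middle of its string, so the
    hypothesis for all rulers would not apply.\<close>
  have "\<exists>q. \<forall>N n s w p. n \<le> N \<and> (\<forall>j<m. s (LoopT j) = index_tape n 0) \<and> s InT = bits_tape w p \<longrightarrow>
    runs (skip m) s (s(InT := bits_tape w (p + n ^ m))) (poly q N)"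
  proof (induction m)
    case 0
    show ?case
      by (rule exI[of _ "[:1:]"]) (auto intro!: runs_weaken[OF runs_right])
  next
    case (Suc m)
    then obtain q where q: "\<And>N n s w p. n \<le> N \<Longrightarrow> (\<forall>j<m. s (LoopT j) = index_tape n 0) \<Longrightarrow>
        s InT = bits_tape w p \<Longrightarrow>
        runs (skip m) s (s(InT := bits_tape w (p + n ^ m))) (poly q N)" by blast
    have "runs (skip (Suc m)) s (s(InT := bits_tape w (p + n ^ Suc m)))
        (poly ([:0, 1:] * (q + [:5:]) + [:7:]) N)"
      if n: "n \<le> N" and L: "\<forall>j<Suc m. s (LoopT j) = index_tape n 0" and I: "s InT = bits_tape w p"
      for N n s w p
    proof -
      define S where "S j = s(InT := bits_tape w (p + j * n ^ m))" for j
      have "runs (sweep (LoopT m) 0 (skip m)) s (s(InT := bits_tape w (p + n ^ Suc m)))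
        (poly ([:0, 1:] * (q + [:5:]) + [:7:]) N)"
      proof (rule runs_sweep_all[where S = S and w = "one_hot n 0" and t = "poly q N" and N = N and n = n])
        fix j assume "j < n"
        show "runs (skip m) ((S j)(LoopT m := bits_tape (one_hot n 0) j))
          ((S (Suc j))(LoopT m := bits_tape (one_hot n 0) j)) (poly q N)"
          by (rule runs_weaken[OF q[OF n, where p = "p + j * n ^ m" and w = w]])
             (use L in \<open>auto simp: S_def fun_eq_iff algebra_simps\<close>)
      next
        show "s = (S 0)(LoopT m := bits_tape (one_hot n 0) 0)"
          using L I by (auto simp: S_def fun_eq_iff index_tape_def)
        show "s(InT := bits_tape w (p + n ^ Suc m)) = (S n)(LoopT m := bits_tape (one_hot n 0) 0)"
          using L by (auto simp: S_def fun_eq_iff index_tape_def)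
      qed (use n in auto)
      then show ?thesis by simp
    qed
    then show ?case by blast
  qed
  then obtain q where "\<forall>N n s w p. n \<le> N \<and> (\<forall>j<m. s (LoopT j) = index_tape n 0) \<and>
    s InT = bits_tape w p \<longrightarrow> runs (skip m) s (s(InT := bits_tape w (p + n ^ m))) (poly q N)" ..
  then show ?thesis by (intro exI[of _ q]) simp
qed

fun skips :: "nat list \<Rightarrow> tape_name prog" where
  "skips [] = Nop"
| "skips (k # ks) = skip k ;; skips ks"

lemma runs_skips:
  "\<exists>q. \<forall>N n s w p. n \<le> N \<and> (\<forall>j. s (LoopT j) = index_tape n 0) \<and> s InT = bits_tape w p \<longrightarrow>
    runs (skips ks) s (s(InT := bits_tape w (p + sum_list (map (\<lambda>k. n ^ k) ks)))) (poly q N)"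
proof (induction ks)
  case Nil
  show ?case by (rule exI[of _ "[:1:]"]) (auto intro!: runs_weaken[OF runs_Nop[OF order_refl]] simp: fun_eq_iff)
next
  case (Cons k ks)
  obtain q1 where q1: "\<And>N n s w p. n \<le> N \<Longrightarrow> (\<forall>j. s (LoopT j) = index_tape n 0) \<Longrightarrow>
      s InT = bits_tape w p \<Longrightarrow>
      runs (skip k) s (s(InT := bits_tape w (p + n ^ k))) (poly q1 N)" using runs_skip[of k] by blast
  from Cons obtain q2 where q2: "\<And>N n s w p. n \<le> N \<Longrightarrow> (\<forall>j. s (LoopT j) = index_tape n 0) \<Longrightarrow>
      s InT = bits_tape w p \<Longrightarrow>
      runs (skips ks) s (s(InT := bits_tape w (p + sum_list (map (\<lambda>k. n ^ k) ks)))) (poly q2 N)"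
    by blast
  show ?case
  proof (rule exI[of _ "q1 + q2 + [:1:]"], intro allI impI, elim conjE)
    fix N n s w p
    assume a: "n \<le> N" "\<forall>j. s (LoopT j) = index_tape n 0" "s InT = bits_tape w p"
    show "runs (skips (k # ks)) s (s(InT := bits_tape w (p + sum_list (map (\<lambda>k. n ^ k) (k # ks)))))
        (poly (q1 + q2 + [:1:]) N)"
      using runs_Seq[OF q1[OF a] q2[where p = "p + n ^ k" and w = w], OF a(1)] a(2)
      by (simp add: add.assoc)
  qed
qed

text \<open>The number with the base-\<open>n\<close> digits \<open>is\<close>, most significant
  first; this is the lexicographic rank of the tuple.\<close>

fun table_index :: "nat \<Rightarrow> nat list \<Rightarrow> nat" where
  "table_index n [] = 0"
| "table_index n (i # is) = i * n ^ length is + table_index n is"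

fun skip_to :: "tape_name list \<Rightarrow> tape_name prog" where
  "skip_to [] = Nop"
| "skip_to (x # xs) = sweep x (bit_sym True) (skip (length xs)) ;; skip_to xs"

text \<open>The offset is accumulated digit by digit: the sweep over \<open>x\<close> repeats a skip
  of \<open>n ^ length xs\<close> cells as often as the index on \<open>x\<close> says. Indices are
  a function \<open>ix\<close> of the tape because one tape may occur several times in
  \<open>xs\<close>. The input tape and the rulers are excluded since their heads move during the
  skips.\<close>

lemma runs_skip_to:
  assumes "\<forall>x \<in> set xs. x \<noteq> InT \<and> (\<forall>j. x \<noteq> LoopT j)"
  shows "\<exists>q. \<forall>N n s w p ix. n \<le> N \<and> (\<forall>j. s (LoopT j) = index_tape n 0) \<and> s InT = bits_tape w p \<and>
      (\<forall>x \<in> set xs. s x = index_tape n (ix x) \<and> ix x < n) \<longrightarrow>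
    runs (skip_to xs) s (s(InT := bits_tape w (p + table_index n (map ix xs)))) (poly q N)"
  using assms
proof (induction xs)
  case Nil
  show ?case by (rule exI[of _ "[:1:]"]) (auto intro!: runs_weaken[OF runs_Nop[OF order_refl]] simp: fun_eq_iff)
next
  case (Cons x xs)
  obtain q1 where q1: "\<And>N n s w p. n \<le> N \<Longrightarrow> (\<forall>j. s (LoopT j) = index_tape n 0) \<Longrightarrow>
      s InT = bits_tape w p \<Longrightarrow>
      runs (skip (length xs)) s (s(InT := bits_tape w (p + n ^ length xs))) (poly q1 N)"
    using runs_skip[of "length xs"] by blast
  obtain q2 where q2: "\<And>N n s w p ix. n \<le> N \<Longrightarrow> (\<forall>j. s (LoopT j) = index_tape n 0) \<Longrightarrow>
      s InT = bits_tape w p \<Longrightarrow> (\<forall>x \<in> set xs. s x = index_tape n (ix x) \<and> ix x < n) \<Longrightarrow>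
      runs (skip_to xs) s (s(InT := bits_tape w (p + table_index n (map ix xs)))) (poly q2 N)"
    using Cons.IH Cons.prems by (metis list.set_intros(2))
  have x: "x \<noteq> InT" "\<And>j. x \<noteq> LoopT j" using Cons.prems by auto
  let ?q = "[:0, 1:] * (q1 + [:5:]) + q2 + [:8:]"
  show ?case
  proof (rule exI[of _ ?q], intro allI impI, elim conjE)
    fix N n s w p ix
    assume a: "n \<le> N" "\<forall>j. s (LoopT j) = index_tape n 0" "s InT = bits_tape w p"
      and ix: "\<forall>x \<in> set (x # xs). s x = index_tape n (ix x) \<and> ix x < n"
    define S where "S j = s(InT := bits_tape w (p + j * n ^ length xs))" for j
    have 1: "runs (sweep x (bit_sym True) (skip (length xs))) s (S (ix x)) (N * (poly q1 N + 5) + 7)"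
    proof (rule runs_sweep_below[where S = S and i = "ix x" and n = n and t = "poly q1 N" and N = N])
      fix j assume "j < ix x"
      let ?T = "bits_tape (one_hot n (ix x)) j"
      show "runs (skip (length xs)) ((S j)(x := ?T)) ((S (Suc j))(x := ?T)) (poly q1 N)"
        by (rule runs_weaken[OF q1[OF a(1), where p = "p + j * n ^ length xs" and w = w]])
           (use a x x(2)[THEN not_sym] in \<open>auto simp: S_def fun_eq_iff algebra_simps\<close>)
    qed (use a x ix in \<open>auto simp: S_def fun_eq_iff\<close>)
    have 2: "runs (skip_to xs) (S (ix x))
       ((S (ix x))(InT := bits_tape w (p + ix x * n ^ length xs + table_index n (map ix xs)))) (poly q2 N)"
      by (rule q2) (use a ix Cons.prems in \<open>auto simp: S_def\<close>)
    show "runs (skip_to (x # xs)) s (s(InT := bits_tape w (p + table_index n (map ix (x # xs)))))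
        (poly ?q N)"
      unfolding skip_to.simps
      by (rule runs_weaken[OF runs_Seq[OF 1 2 order_refl]]) (auto simp: S_def add.assoc)
  qed
qed

definition seek_tables :: "tape_name prog" where
  "seek_tables = Until InT (bit_sym False) (Mv InT MoveRight) ;; Mv InT MoveRight"

lemma runs_seek_tables:
  assumes "s InT = bits_tape w 0" "w = replicate n True @ [False] @ v"
  shows "runs seek_tables s (s(InT := bits_tape w (Suc n))) (2 * n + 3)"
proof -
  let ?S = "\<lambda>j. s(InT := bits_tape w j)"
  have "runs (Until InT (bit_sym False) (Mv InT MoveRight)) (?S 0) (?S n) (2 * n + 1)"
  proof (rule runs_Until[where t = 1])
    fix j assume "j < n"
    then show "scan (?S j InT) \<noteq> bit_sym False" using assms(2) by (simp add: scan_bits_tape nth_append)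
    show "runs (Mv InT MoveRight) (?S j) (?S (Suc j)) 1"
      by (rule runs_weaken[OF runs_right]) auto
  qed (use assms(2) in \<open>auto simp: scan_bits_tape nth_append\<close>)
  moreover have "?S 0 = s" using assms(1) by (simp add: fun_upd_idem)
  ultimately have 1: "runs (Until InT (bit_sym False) (Mv InT MoveRight)) s (?S n) (2 * n + 1)" by simp
  have 2: "runs (Mv InT MoveRight) (?S n) (?S (Suc n)) 1"
    by (rule runs_weaken[OF runs_right]) auto
  show ?thesis unfolding seek_tables_def by (rule runs_Seq[OF 1 2]) simp
qed


section \<open>Layout of the encoded structure\<close>

abbreviation size_of :: "'a ordered_struct \<Rightarrow> nat" where
  "size_of A \<equiv> length (enumeration A)"

lemma enumeration:
  assumes "A \<in> structures \<sigma>"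
  shows "set (enumeration A) = universe A" "distinct (enumeration A)"
    "sorted_wrt (\<lambda>a b. (a, b) \<in> less_eq_rel A) (enumeration A)"
  using theI'[OF ex1_enumeration[OF assms], folded enumeration_def] by auto

lemma size_of_pos: "A \<in> structures \<sigma> \<Longrightarrow> 0 < size_of A"
  using enumeration(1)[of A \<sigma>] by (auto simp: structures_def)

lemma size_of_le: "size_of A \<le> length (enc_struct \<sigma> A)"
  by (simp add: enc_struct_def Let_def)

lemma enumeration_le_iff:
  assumes A: "A \<in> structures \<sigma>" and "i < size_of A" "j < size_of A"
  shows "(enumeration A ! i, enumeration A ! j) \<in> less_eq_rel A \<longleftrightarrow> i \<le> j"
proof -
  let ?xs = "enumeration A"
  have lin: "linear_order_on (universe A) (less_eq_rel A)" using A by (simp add: structures_def)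
  have lt: "(?xs ! k, ?xs ! l) \<in> less_eq_rel A" if "k < l" "l < size_of A" for k l
    using enumeration(3)[OF A] that by (simp add: sorted_wrt_iff_nth_less)
  have refl: "(?xs ! i, ?xs ! i) \<in> less_eq_rel A"
    using lin enumeration(1)[OF A] assms(2) by (auto simp: order_on_defs refl_on_def)
  have "i \<le> j" if "(?xs ! i, ?xs ! j) \<in> less_eq_rel A"
  proof (rule ccontr)
    assume "\<not> i \<le> j"
    then have "?xs ! i = ?xs ! j" using lt[of j i] that assms lin
      by (auto simp: order_on_defs antisym_def)
    then show False using enumeration(2)[OF A] assms \<open>\<not> i \<le> j\<close> by (simp add: nth_eq_iff_index_eq)
  qed
  then show ?thesis using lt[of i j] refl assms by (cases "i = j") auto
qed

lemma concat_nth: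
  assumes "i < length ls" "j < length (ls ! i)"
  shows "concat ls ! (sum_list (map length (take i ls)) + j) = ls ! i ! j \<and>
    sum_list (map length (take i ls)) + j < length (concat ls)"
  using assms
proof (induction ls arbitrary: i)
  case (Cons l ls)
  then show ?case by (cases i) (auto simp: nth_append add.assoc)
qed simp

lemma length_product_lists_replicate:
  "length (product_lists (replicate k xs)) = length xs ^ k"
  by (induction k) (simp_all add: length_concat comp_def sum_list_triv)

text \<open>The tuples that start with the element of index \<open>i\<close> form a block preceded
  by \<open>i\<close> blocks of \<open>length xs ^ (k - 1)\<close> tuples each, which is the
  recursion of \<open>table_index\<close>.\<close>

lemma product_lists_nth:
  assumes "length is = k" "\<forall>i \<in> set is. i < length xs"
  shows "table_index (length xs) is < length xs ^ k \<and>
    product_lists (replicate k xs) ! table_index (length xs) is = map ((!) xs) is"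
  using assms
proof (induction "is" arbitrary: k)
  case Nil
  then show ?case by simp
next
  case (Cons i "is")
  then obtain k' where k: "k = Suc k'" "length is = k'" by (cases k) auto
  let ?n = "length xs" and ?P = "product_lists (replicate k' xs)"
  let ?ls = "map (\<lambda>x. map (Cons x) ?P) xs"
  have IH: "table_index ?n is < ?n ^ k'" "?P ! table_index ?n is = map ((!) xs) is"
    using Cons k by auto
  have i: "i < ?n" using Cons.prems by simp
  have "map length (take i ?ls) = replicate i (?n ^ k')"
    using i by (auto intro!: nth_equalityI simp: length_product_lists_replicate)
  then have "sum_list (map length (take i ?ls)) = i * ?n ^ k'"
    by (simp add: sum_list_replicate)
  then show ?case
    using concat_nth[of i ?ls "table_index ?n is"] i IH k
    by (simp add: length_product_lists_replicate length_concat comp_def sum_list_triv)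
qed

definition table :: "'a list \<Rightarrow> nat \<Rightarrow> 'a list set \<Rightarrow> bool list" where
  "table xs k R = map (\<lambda>t. t \<in> R) (product_lists (replicate k xs))"

lemma length_table [simp]: "length (table xs k R) = length xs ^ k"
  by (simp add: table_def length_product_lists_replicate)

definition all_tables :: "vocabulary \<Rightarrow> 'a ordered_struct \<Rightarrow> bool list list" where
  "all_tables \<sigma> A = map (\<lambda>(k, R). table (enumeration A) k R) (zip (rel_arities \<sigma>) (rel_vals A)) @
     map (\<lambda>c. map (\<lambda>x. x = c) (enumeration A)) (const_vals A)"

lemma enc_struct_tables:
  "enc_struct \<sigma> A = replicate (size_of A) True @ [False] @ concat (all_tables \<sigma> A)"
  by (simp add: enc_struct_def Let_def all_tables_def table_def)

text \<open>The table of a constant has as many cells as that of a unary relation, so for offsets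
  the constants count as further symbols of arity 1.\<close>

lemma enc_struct_nth:
  assumes A: "A \<in> structures \<sigma>" and i: "i < length (all_tables \<sigma> A)"
    and j: "j < length (all_tables \<sigma> A ! i)"
  defines "p \<equiv> Suc (size_of A) + sum_list (map (\<lambda>k. size_of A ^ k)
      (take i (rel_arities \<sigma> @ replicate (const_count \<sigma>) 1))) + j"
  shows "p < length (enc_struct \<sigma> A)" "enc_struct \<sigma> A ! p = all_tables \<sigma> A ! i ! j"
proof -
  have "map length (all_tables \<sigma> A) =
      map (\<lambda>k. size_of A ^ k) (rel_arities \<sigma> @ replicate (const_count \<sigma>) 1)"
    using A by (auto simp: all_tables_def structures_def nth_append intro!: nth_equalityI)
  then have "sum_list (map length (take i (all_tables \<sigma> A))) = sum_list (map (\<lambda>k. size_of A ^ k)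
      (take i (rel_arities \<sigma> @ replicate (const_count \<sigma>) 1)))"
    by (metis take_map)
  then show "p < length (enc_struct \<sigma> A)" "enc_struct \<sigma> A ! p = all_tables \<sigma> A ! i ! j"
    using concat_nth[OF i j] by (auto simp: enc_struct_tables p_def nth_append add.assoc)
qed

lemma relation_bit:
  assumes A: "A \<in> structures \<sigma>" and i: "i < length (rel_arities \<sigma>)"
    and "length is = rel_arities \<sigma> ! i" "\<forall>j \<in> set is. j < size_of A"
  defines "p \<equiv> Suc (size_of A) + sum_list (map (\<lambda>k. size_of A ^ k) (take i (rel_arities \<sigma>))) +
      table_index (size_of A) is"
  shows "p < length (enc_struct \<sigma> A)"
    "enc_struct \<sigma> A ! p = (map ((!) (enumeration A)) is \<in> rel_vals A ! i)"
proof -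
  have l: "length (rel_vals A) = length (rel_arities \<sigma>)" using A by (simp add: structures_def)
  then have t: "all_tables \<sigma> A ! i = table (enumeration A) (rel_arities \<sigma> ! i) (rel_vals A ! i)"
    using i by (simp add: all_tables_def nth_append)
  have i': "i < length (all_tables \<sigma> A)" using i l by (simp add: all_tables_def)
  note ti = product_lists_nth[OF assms(3,4)]
  show "p < length (enc_struct \<sigma> A)"
    "enc_struct \<sigma> A ! p = (map ((!) (enumeration A)) is \<in> rel_vals A ! i)"
    using enc_struct_nth[OF A i', of "table_index (size_of A) is"] ti i
    by (simp_all add: t p_def) (simp_all add: table_def length_product_lists_replicate)
qed

text \<open>The default 0 keeps the index below the size for every \<open>c\<close>. It is also what
  initialization leaves on the constant tapes, so copying the actual constants establishes this
  function on all of them.\<close>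

definition const_index :: "vocabulary \<Rightarrow> 'a ordered_struct \<Rightarrow> nat \<Rightarrow> nat" where
  "const_index \<sigma> A c = (if c < const_count \<sigma>
     then SOME i. i < size_of A \<and> enumeration A ! i = const_vals A ! c else 0)"

lemma const_index:
  assumes A: "A \<in> structures \<sigma>"
  shows "const_index \<sigma> A c < size_of A"
    "c < const_count \<sigma> \<Longrightarrow> enumeration A ! const_index \<sigma> A c = const_vals A ! c"
proof -
  have *: "\<exists>i. i < size_of A \<and> enumeration A ! i = const_vals A ! c" if "c < const_count \<sigma>"
  proof -
    have "const_vals A ! c \<in> set (const_vals A)" "set (const_vals A) \<subseteq> universe A"
      using A that by (auto simp: structures_def)
    then have "const_vals A ! c \<in> set (enumeration A)" using enumeration(1)[OF A] by blast
    then show ?thesis by (simp add: in_set_conv_nth)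
  qed
  show "const_index \<sigma> A c < size_of A"
    using size_of_pos[OF A] someI_ex[OF *] by (simp add: const_index_def)
  show "c < const_count \<sigma> \<Longrightarrow> enumeration A ! const_index \<sigma> A c = const_vals A ! c"
    using someI_ex[OF *] by (simp add: const_index_def)
qed

lemma constant_bit:
  assumes A: "A \<in> structures \<sigma>" and c: "c < const_count \<sigma>" and j: "j < size_of A"
  defines "p \<equiv> Suc (size_of A) +
      sum_list (map (\<lambda>k. size_of A ^ k) (rel_arities \<sigma> @ replicate c 1)) + j"
  shows "p < length (enc_struct \<sigma> A)" "enc_struct \<sigma> A ! p = (j = const_index \<sigma> A c)"
proof -
  let ?i = "length (rel_arities \<sigma>) + c"
  have l: "length (rel_vals A) = length (rel_arities \<sigma>)" "length (const_vals A) = const_count \<sigma>"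
    using A by (simp_all add: structures_def)
  have t: "all_tables \<sigma> A ! ?i = map (\<lambda>x. x = const_vals A ! c) (enumeration A)"
    using l c by (simp add: all_tables_def nth_append)
  have i': "?i < length (all_tables \<sigma> A)" using l c by (simp add: all_tables_def)
  have "(enumeration A ! j = const_vals A ! c) = (j = const_index \<sigma> A c)"
    using const_index[OF A, of c] c j enumeration(2)[OF A] nth_eq_iff_index_eq by metis
  then show "p < length (enc_struct \<sigma> A)" "enc_struct \<sigma> A ! p = (j = const_index \<sigma> A c)"
    using enc_struct_nth[OF A i', of j] j c by (simp_all add: t p_def)
qed


section \<open>Evaluating first-order formulas\<close>

text \<open>The normal form of all tapes between routines: input and index tapes are rewound and the
  output head is at the end of the word \<open>w\<close>. The functions \<open>c\<close> and
  \<open>e\<close> give the indices on the constant and variable tapes, where \<open>e\<close> is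
  indexed by tape numbers and not by variables of the formula.\<close>

fun store :: "vocabulary \<Rightarrow> 'a ordered_struct \<Rightarrow> (nat \<Rightarrow> nat) \<Rightarrow> bool \<Rightarrow> (nat \<Rightarrow> nat) \<Rightarrow> bool list \<Rightarrow>
    tape_name store" where
  "store \<sigma> A c r e w InT = bits_tape (enc_struct \<sigma> A) 0"
| "store \<sigma> A c r e w FlagT = bits_tape [r] 0"
| "store \<sigma> A c r e w (LoopT j) = index_tape (size_of A) 0"
| "store \<sigma> A c r e w (ConstT j) = index_tape (size_of A) (c j)"
| "store \<sigma> A c r e w (VarT j) = index_tape (size_of A) (e j)"
| "store \<sigma> A c r e w OutT = bits_tape w (length w)"

lemma store_eqI:
  assumes "\<And>x. s x = store \<sigma> A c r e w x"
  shows "s = store \<sigma> A c r e w"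
  using assms by auto

lemma store_upd [simp]:
  "(store \<sigma> A c r e w)(FlagT := bits_tape [r'] 0) = store \<sigma> A c r' e w"
  "(store \<sigma> A c r e w)(VarT d := index_tape (size_of A) i) = store \<sigma> A c r (e(d := i)) w"
  "(store \<sigma> A c r e w)(ConstT d := index_tape (size_of A) i) = store \<sigma> A (c(d := i)) r e w"
  "l = length w' \<Longrightarrow> (store \<sigma> A c r e w)(OutT := bits_tape w' l) = store \<sigma> A c r e w'"
  by (rule store_eqI, rename_tac x, case_tac x; simp)+

section \<open>The truth flag and the comparison of two indices\<close>

definition set_flag :: "bool \<Rightarrow> tape_name prog" where
  "set_flag b = Wr FlagT (bit_sym b)"

lemma runs_set_flag:
  assumes "s FlagT = bits_tape [r] 0" "1 \<le> t"
  shows "runs (set_flag b) s (s(FlagT := bits_tape [b] 0)) t"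
  unfolding set_flag_def
  by (rule runs_weaken[OF runs_write[where w = "[r]" and p = 0 and x = FlagT and s = s]]) (use assms in auto)

definition read_flag :: "tape_name \<Rightarrow> tape_name prog" where
  "read_flag x = Cond x (bit_sym True) (set_flag True) (set_flag False)"

lemma runs_read_flag:
  assumes "s FlagT = bits_tape [r] 0" "s x = bits_tape w p" "p < length w"
  shows "runs (read_flag x) s (s(FlagT := bits_tape [w ! p] 0)) 2"
  unfolding read_flag_def
proof (rule runs_Cond)
  show "runs (set_flag True) s (s(FlagT := bits_tape [w ! p] 0)) 1"
    if "scan (s x) = bit_sym True"
    using that assms runs_set_flag[of s r 1 True] by (simp add: scan_bits_tape)
  show "runs (set_flag False) s (s(FlagT := bits_tape [w ! p] 0)) 1"
    if "scan (s x) \<noteq> bit_sym True"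
    using that assms runs_set_flag[of s r 1 False] by (simp add: scan_bits_tape)
qed simp

text \<open>The head of \<open>y\<close> accompanies that of \<open>x\<close> up to the mark of
  \<open>x\<close>; the cell it reaches is marked iff the indices agree. A tape cannot accompany
  itself, hence the separate case.\<close>

definition test_eq :: "tape_name \<Rightarrow> tape_name \<Rightarrow> tape_name prog" where
  "test_eq x y = (if x = y then set_flag True
     else sweep x (bit_sym True) (Mv y MoveRight) ;; read_flag y ;; rewind y)"

lemma runs_test_eq:
  assumes "s x = index_tape n i" "s y = index_tape n j" "s FlagT = bits_tape [r] 0"
    "i < n" "j < n" "n \<le> N" "x \<noteq> FlagT" "y \<noteq> FlagT" "x = y \<Longrightarrow> i = j"
  shows "runs (test_eq x y) s (s(FlagT := bits_tape [i = j] 0)) (8 * N + 20)"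
proof (cases "x = y")
  case True
  then show ?thesis using True runs_set_flag[of s r _ True] assms by (simp add: test_eq_def)
next
  case False
  have 1: "runs (sweep x (bit_sym True) (Mv y MoveRight)) s
      (s(y := bits_tape (one_hot n j) i)) (N * 6 + 7)"
    by (rule runs_sweep_below[where S = "\<lambda>k. s(y := bits_tape (one_hot n j) k)" and i = i
          and n = n and t = 1 and N = N])
       (use assms False in \<open>auto simp: fun_eq_iff index_tape_def intro!: runs_weaken[OF runs_right]\<close>)
  let ?s = "s(y := bits_tape (one_hot n j) i)"
  have 2: "runs (read_flag y) ?s (?s(FlagT := bits_tape [i = j] 0)) 2"
    by (rule runs_weaken[OF runs_read_flag[where w = "one_hot n j" and p = i]])
       (use assms in auto)
  have 3: "runs (rewind y) (?s(FlagT := bits_tape [i = j] 0))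
      (s(FlagT := bits_tape [i = j] 0)) (2 * N + 5)"
    by (rule runs_weaken[OF runs_rewind[OF _ _ order_refl, where p = i and w = "one_hot n j"]])
       (use assms in \<open>auto simp: fun_eq_iff index_tape_def\<close>)
  show ?thesis
    using False runs_Seq[OF 1 runs_Seq[OF 2 3 order_refl], of "8 * N + 20"]
    by (simp add: test_eq_def)
qed

definition test_le :: "tape_name \<Rightarrow> tape_name \<Rightarrow> tape_name prog" where
  "test_le x y = (if x = y then set_flag True
     else set_flag True ;;
       sweep x (bit_sym True) (Cond y (bit_sym True) (set_flag False) Nop ;; Mv y MoveRight) ;; rewind y)"

lemma runs_test_le:
  assumes "s x = index_tape n i" "s y = index_tape n j" "s FlagT = bits_tape [r] 0"
    "i < n" "j < n" "n \<le> N" "x \<noteq> FlagT" "y \<noteq> FlagT" "x = y \<Longrightarrow> i = j"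
  shows "runs (test_le x y) s (s(FlagT := bits_tape [i \<le> j] 0)) (11 * N + 20)"
proof (cases "x = y")
  case True
  then show ?thesis using runs_set_flag[of s r _ True] assms by (simp add: test_le_def)
next
  case False
  \<comment> \<open>After \<open>k\<close> cells the flag says \<open>k \<le> j\<close>: it drops
    exactly when the head of \<open>y\<close> passes the mark of \<open>y\<close>.\<close>
  define S where "S k = s(y := bits_tape (one_hot n j) k, FlagT := bits_tape [k \<le> j] 0)" for k
  have 0: "runs (set_flag True) s (S 0) 1"
    by (rule runs_weaken[OF runs_set_flag[where r = r and t = 1]])
       (use assms in \<open>auto simp: S_def fun_eq_iff index_tape_def\<close>)
  have 1: "runs (sweep x (bit_sym True) (Cond y (bit_sym True) (set_flag False) Nop ;; Mv y MoveRight))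
      (S 0) (S i) (N * 9 + 7)"
  proof (rule runs_sweep_below[where S = S and i = i and n = n and t = 4 and N = N])
    fix k assume k: "k < i"
    let ?x = "bits_tape (one_hot n i) k"
    let ?m = "(S k)(x := ?x, FlagT := bits_tape [Suc k \<le> j] 0)"
    have a: "runs (Cond y (bit_sym True) (set_flag False) Nop) ((S k)(x := ?x)) ?m 2"
    proof (rule runs_Cond[where t = 1])
      assume "scan (((S k)(x := ?x)) y) = bit_sym True"
      then have "k = j" using assms False k by (auto simp: S_def scan_bits_tape split: if_splits)
      then show "runs (set_flag False) ((S k)(x := ?x)) ?m 1"
        using runs_set_flag[of "(S k)(x := ?x)" "k \<le> j" 1 False] assms by (auto simp: S_def)
    next
      assume "scan (((S k)(x := ?x)) y) \<noteq> bit_sym True"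
      then have "k \<noteq> j" using assms False k by (auto simp: S_def scan_bits_tape split: if_splits)
      then have "(Suc k \<le> j) = (k \<le> j)" by linarith
      then have "?m = (S k)(x := ?x)" using assms by (auto simp: S_def fun_eq_iff)
      then show "runs Nop ((S k)(x := ?x)) ?m 1" by (simp add: runs_Nop)
    qed simp
    have b: "runs (Mv y MoveRight) ?m ((S (Suc k))(x := ?x)) 1"
      by (rule runs_weaken[OF runs_right[where w = "one_hot n j" and p = k]])
         (use assms False in \<open>auto simp: S_def fun_eq_iff\<close>)
    show "runs (Cond y (bit_sym True) (set_flag False) Nop ;; Mv y MoveRight)
      ((S k)(x := ?x)) ((S (Suc k))(x := ?x)) 4"
      by (rule runs_Seq[OF a b]) simp
  qed (use assms False in \<open>auto simp: S_def fun_eq_iff\<close>)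
  have 2: "runs (rewind y) (S i) (s(FlagT := bits_tape [i \<le> j] 0)) (2 * N + 5)"
    by (rule runs_weaken[OF runs_rewind[OF _ _ order_refl, where p = i and w = "one_hot n j"]])
       (use assms in \<open>auto simp: fun_eq_iff index_tape_def S_def\<close>)
  show ?thesis
    using False runs_Seq[OF 0 runs_Seq[OF 1 2 order_refl], of "11 * N + 20"]
    by (simp add: test_le_def)
qed


text \<open>Variable tapes from \<open>d\<close> on are free for quantifiers and hold index 0. The
  old flag \<open>r\<close> is arbitrary, and one polynomial has to serve all structures, indices
  and outputs written so far.\<close>

definition evaluates :: "vocabulary \<Rightarrow> tape_name prog \<Rightarrow> nat \<Rightarrow>
    ('a ordered_struct \<Rightarrow> (nat \<Rightarrow> nat) \<Rightarrow> bool) \<Rightarrow> bool" where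
  "evaluates \<sigma> p d f \<longleftrightarrow> (\<exists>q. \<forall>A \<in> structures \<sigma>. \<forall>r e w.
     (\<forall>j. e j < size_of A) \<and> (\<forall>j\<ge>d. e j = 0) \<longrightarrow>
     runs p (store \<sigma> A (const_index \<sigma> A) r e w) (store \<sigma> A (const_index \<sigma> A) (f A e) e w)
       (poly q (length (enc_struct \<sigma> A))))"

lemma evaluatesI:
  assumes "\<And>A r e w. A \<in> structures \<sigma> \<Longrightarrow> (\<forall>j. e j < size_of A) \<Longrightarrow> (\<forall>j\<ge>d. e j = 0) \<Longrightarrow>
     runs p (store \<sigma> A (const_index \<sigma> A) r e w) (store \<sigma> A (const_index \<sigma> A) (f A e) e w)
       (poly q (length (enc_struct \<sigma> A)))"
  shows "evaluates \<sigma> p d f"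
  unfolding evaluates_def using assms by blast

lemma evaluatesE:
  assumes "evaluates \<sigma> p d f"
  obtains q where "\<And>A r e w. A \<in> structures \<sigma> \<Longrightarrow> (\<forall>j. e j < size_of A) \<Longrightarrow> (\<forall>j\<ge>d. e j = 0) \<Longrightarrow>
     runs p (store \<sigma> A (const_index \<sigma> A) r e w) (store \<sigma> A (const_index \<sigma> A) (f A e) e w)
       (poly q (length (enc_struct \<sigma> A)))"
  using assms unfolding evaluates_def by blast

lemma evaluates_cong:
  assumes "evaluates \<sigma> p d f"
    and "\<And>A e. A \<in> structures \<sigma> \<Longrightarrow> (\<forall>j. e j < size_of A) \<Longrightarrow> f A e = g A e"
  shows "evaluates \<sigma> p d g"
proof -
  obtain q where q: "\<And>A r e w. A \<in> structures \<sigma> \<Longrightarrow> (\<forall>j. e j < size_of A) \<Longrightarrow> (\<forall>j\<ge>d. e j = 0) \<Longrightarrow>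
     runs p (store \<sigma> A (const_index \<sigma> A) r e w) (store \<sigma> A (const_index \<sigma> A) (f A e) e w)
       (poly q (length (enc_struct \<sigma> A)))" using assms(1) by (rule evaluatesE) blast
  show ?thesis by (rule evaluatesI[where q = q]) (simp add: q flip: assms(2))
qed

lemma evaluates_not:
  assumes "evaluates \<sigma> p d f"
  shows "evaluates \<sigma> (p ;; Cond FlagT (bit_sym True) (set_flag False) (set_flag True)) d (\<lambda>A e. \<not> f A e)"
proof -
  obtain q where q: "\<And>A r e w. A \<in> structures \<sigma> \<Longrightarrow> (\<forall>j. e j < size_of A) \<Longrightarrow> (\<forall>j\<ge>d. e j = 0) \<Longrightarrow>
     runs p (store \<sigma> A (const_index \<sigma> A) r e w) (store \<sigma> A (const_index \<sigma> A) (f A e) e w)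
       (poly q (length (enc_struct \<sigma> A)))" using assms by (rule evaluatesE) blast
  show ?thesis
  proof (rule evaluatesI[where q = "q + [:3:]"])
    fix A :: "'a ordered_struct" and r and e :: "nat \<Rightarrow> nat" and w
    assume A: "A \<in> structures \<sigma>" "\<forall>j. e j < size_of A" "\<forall>j\<ge>d. e j = 0"
    let ?s = "\<lambda>r. store \<sigma> A (const_index \<sigma> A) r e w"
    have s: "runs (set_flag b) (?s r) (?s b) 1" for b r
      using runs_set_flag[of "?s r" r 1 b] by simp
    have "runs (Cond FlagT (bit_sym True) (set_flag False) (set_flag True)) (?s (f A e)) (?s (\<not> f A e)) 2"
      by (rule runs_Cond[where t = 1]) (use s in \<open>auto simp: scan_bits_tape\<close>)
    then show "runs (p ;; Cond FlagT (bit_sym True) (set_flag False) (set_flag True)) (?s r)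
        (?s (\<not> f A e)) (poly (q + [:3:]) (length (enc_struct \<sigma> A)))"
      by (intro runs_Seq[OF q[OF A]]) auto
  qed
qed

text \<open>For \<open>b\<close> true this evaluates the conjunction, and for \<open>b\<close> false the disjunction.\<close>

definition junction :: "bool \<Rightarrow> tape_name prog \<Rightarrow> tape_name prog \<Rightarrow> tape_name prog" where
  "junction b p p' = p ;; Cond FlagT (bit_sym b) p' Nop"

lemma evaluates_junction:
  assumes "evaluates \<sigma> p d f" "evaluates \<sigma> p' d f'"
  shows "evaluates \<sigma> (junction b p p') d (\<lambda>A e. if f A e = b then f' A e else \<not> b)"
proof -
  obtain q where q: "\<And>A r e w. A \<in> structures \<sigma> \<Longrightarrow> (\<forall>j. e j < size_of A) \<Longrightarrow> (\<forall>j\<ge>d. e j = 0) \<Longrightarrow>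
     runs p (store \<sigma> A (const_index \<sigma> A) r e w) (store \<sigma> A (const_index \<sigma> A) (f A e) e w)
       (poly q (length (enc_struct \<sigma> A)))" using assms(1) by (rule evaluatesE) blast
  obtain q' where q': "\<And>A r e w. A \<in> structures \<sigma> \<Longrightarrow> (\<forall>j. e j < size_of A) \<Longrightarrow> (\<forall>j\<ge>d. e j = 0) \<Longrightarrow>
     runs p' (store \<sigma> A (const_index \<sigma> A) r e w) (store \<sigma> A (const_index \<sigma> A) (f' A e) e w)
       (poly q' (length (enc_struct \<sigma> A)))" using assms(2) by (rule evaluatesE) blast
  show ?thesis
  proof (rule evaluatesI[where q = "q + q' + [:4:]"])
    fix A :: "'a ordered_struct" and r and e :: "nat \<Rightarrow> nat" and w
    assume A: "A \<in> structures \<sigma>" "\<forall>j. e j < size_of A" "\<forall>j\<ge>d. e j = 0"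
    let ?s = "\<lambda>r. store \<sigma> A (const_index \<sigma> A) r e w" and ?N = "length (enc_struct \<sigma> A)"
    let ?g = "if f A e = b then f' A e else \<not> b"
    have "runs (Cond FlagT (bit_sym b) p' Nop) (?s (f A e)) (?s ?g) (poly q' ?N + 2)"
    proof (rule runs_Cond[where t = "poly q' ?N + 1"])
      assume "scan (?s (f A e) FlagT) = bit_sym b"
      then have "f A e = b" by (simp add: scan_bits_tape)
      then show "runs p' (?s (f A e)) (?s ?g) (poly q' ?N + 1)"
        using runs_weaken[OF q'[OF A]] by simp
    next
      assume "scan (?s (f A e) FlagT) \<noteq> bit_sym b"
      then have "f A e = (\<not> b)" by (simp add: scan_bits_tape)
      then show "runs Nop (?s (f A e)) (?s ?g) (poly q' ?N + 1)"
        by (auto intro: runs_Nop)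
    qed simp
    then show "runs (junction b p p') (?s r) (?s ?g) (poly (q + q' + [:4:]) ?N)"
      unfolding junction_def by (intro runs_Seq[OF q[OF A]]) auto
  qed
qed

definition quantifier :: "bool \<Rightarrow> nat \<Rightarrow> tape_name prog \<Rightarrow> tape_name prog" where
  "quantifier b d p = set_flag b ;; for_each (VarT d) (Cond FlagT (bit_sym b) p Nop)"

text \<open>One formula for both quantifiers: for \<open>b\<close> true it is the universal one, and
  for \<open>b\<close> false it denies that all instances are false. The flag starts as
  \<open>b\<close>, and the body runs only while the flag still equals \<open>b\<close>.\<close>

lemma evaluates_quantifier:
  assumes "evaluates \<sigma> p (Suc d) f"
  shows "evaluates \<sigma> (quantifier b d p) d
    (\<lambda>A e. (\<forall>i<size_of A. f A (e(d := i)) = b) = b)"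
proof -
  obtain q where q: "\<And>A r e w. A \<in> structures \<sigma> \<Longrightarrow> (\<forall>j. e j < size_of A) \<Longrightarrow> (\<forall>j\<ge>Suc d. e j = 0) \<Longrightarrow>
     runs p (store \<sigma> A (const_index \<sigma> A) r e w) (store \<sigma> A (const_index \<sigma> A) (f A e) e w)
       (poly q (length (enc_struct \<sigma> A)))" using assms(1) by (rule evaluatesE) blast
  show ?thesis
  proof (rule evaluatesI[where q = "[:0, 1:] * (q + [:32, 4:]) + [:22:]"])
    fix A :: "'a ordered_struct" and r and e :: "nat \<Rightarrow> nat" and w
    assume A: "A \<in> structures \<sigma>" "\<forall>j. e j < size_of A" "\<forall>j\<ge>d. e j = 0"
    let ?s = "\<lambda>r e. store \<sigma> A (const_index \<sigma> A) r e w" and ?N = "length (enc_struct \<sigma> A)"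
    define g where "g k = ((\<forall>i<k. f A (e(d := i)) = b) = b)" for k
    have g0: "g 0 = b" by (simp add: g_def)
    have gS: "g (Suc k) = (if g k = b then f A (e(d := k)) else \<not> b)" for k
      by (auto simp: g_def less_Suc_eq)
    have 1: "runs (set_flag b) (?s r e) (?s b e) 1"
      using runs_set_flag[of "?s r e" r 1 b] by simp
    have 2: "runs (for_each (VarT d) (Cond FlagT (bit_sym b) p Nop)) (?s b e) (?s (g (size_of A)) e)
        (?N * (poly q ?N + 4 * ?N + 32) + 20)"
    proof (rule runs_for_each[where S = "\<lambda>i. ?s (g i) e" and n = "size_of A" and N = ?N
          and t = "poly q ?N + 2"])
      fix i assume i: "i < size_of A"
      let ?e = "e(d := i)"
      have "runs (Cond FlagT (bit_sym b) p Nop) (?s (g i) ?e) (?s (g (Suc i)) ?e) (poly q ?N + 2)"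
      proof (rule runs_Cond[where t = "poly q ?N + 1"])
        assume "scan (?s (g i) ?e FlagT) = bit_sym b"
        then have "g i = b" by (simp add: scan_bits_tape)
        then show "runs p (?s (g i) ?e) (?s (g (Suc i)) ?e) (poly q ?N + 1)"
          using runs_weaken[OF q[OF A(1), of ?e]] A i by (simp add: gS)
      next
        assume "scan (?s (g i) ?e FlagT) \<noteq> bit_sym b"
        then have "g i = (\<not> b)" by (simp add: scan_bits_tape)
        then show "runs Nop (?s (g i) ?e) (?s (g (Suc i)) ?e) (poly q ?N + 1)"
          by (auto intro: runs_Nop simp: gS)
      qed simp
      then show "runs (Cond FlagT (bit_sym b) p Nop)
          ((?s (g i) e)(VarT d := index_tape (size_of A) i))
          ((?s (g (Suc i)) e)(VarT d := index_tape (size_of A) i)) (poly q ?N + 2)" by simp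
    next
      \<comment> \<open>The loop starts and ends with index 0 on its tape; tape \<open>d\<close> is
        free, so this agrees with \<open>e\<close>.\<close>
      have "e(d := 0) = e" using A(3) by (simp add: fun_upd_idem)
      then show "?s b e = (?s (g 0) e)(VarT d := index_tape (size_of A) 0)"
        "?s (g (size_of A)) e = (?s (g (size_of A)) e)(VarT d := index_tape (size_of A) 0)"
        using g0 by simp_all
      show "0 < size_of A" "size_of A \<le> ?N" using size_of_pos[OF A(1)] size_of_le by auto
    qed (simp add: algebra_simps)
    show "runs (quantifier b d p) (?s r e) (?s ((\<forall>i<size_of A. f A (e(d := i)) = b) = b) e)
       (poly ([:0, 1:] * (q + [:32, 4:]) + [:22:]) ?N)"
      unfolding quantifier_def
      by (rule runs_weaken[OF runs_Seq[OF 1 2 order_refl]]) (auto simp: g_def algebra_simps)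
  qed
qed

section \<open>Terms, atomic formulas and the compilation of first-order formulas\<close>

fun term_tape :: "(nat \<Rightarrow> nat) \<Rightarrow> trm \<Rightarrow> tape_name" where
  "term_tape \<rho> (Var v) = VarT (\<rho> v)"
| "term_tape \<rho> (Con c) = ConstT c"

fun term_index :: "vocabulary \<Rightarrow> 'a ordered_struct \<Rightarrow> (nat \<Rightarrow> nat) \<Rightarrow> (nat \<Rightarrow> nat) \<Rightarrow> trm \<Rightarrow> nat" where
  "term_index \<sigma> A \<rho> e (Var v) = e (\<rho> v)"
| "term_index \<sigma> A \<rho> e (Con c) = const_index \<sigma> A c"

definition env :: "'a ordered_struct \<Rightarrow> (nat \<Rightarrow> nat) \<Rightarrow> (nat \<Rightarrow> nat) \<Rightarrow> nat \<Rightarrow> 'a" where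
  "env A \<rho> e v = enumeration A ! e (\<rho> v)"

lemma trm_val_env:
  assumes "A \<in> structures \<sigma>" "trm_over \<sigma> t"
  shows "trm_val A (env A \<rho> e) t = enumeration A ! term_index \<sigma> A \<rho> e t"
  using assms const_index(2)[OF assms(1)] by (cases t) (auto simp: env_def)

lemma term_index_less:
  assumes "A \<in> structures \<sigma>" "\<forall>j. e j < size_of A"
  shows "term_index \<sigma> A \<rho> e t < size_of A"
  using assms const_index(1)[OF assms(1)] by (cases t) auto

lemma term_tape_eq:
  "term_tape \<rho> s = term_tape \<rho> t \<Longrightarrow> term_index \<sigma> A \<rho> e s = term_index \<sigma> A \<rho> e t"
  by (cases s; cases t) auto

lemma term_tape_neq [simp]:
  "term_tape \<rho> t \<noteq> FlagT" "term_tape \<rho> t \<noteq> InT" "term_tape \<rho> t \<noteq> LoopT j" "term_tape \<rho> t \<noteq> OutT"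
  by (cases t; simp)+

lemma store_term_tape [simp]:
  "store \<sigma> A (const_index \<sigma> A) r e w (term_tape \<rho> t) =
     index_tape (size_of A) (term_index \<sigma> A \<rho> e t)"
  by (cases t) auto

definition lookup :: "vocabulary \<Rightarrow> nat \<Rightarrow> tape_name list \<Rightarrow> tape_name prog" where
  "lookup \<sigma> i xs = seek_tables ;; skips (take i (rel_arities \<sigma>)) ;; skip_to xs ;;
     read_flag InT ;; rewind InT"

text \<open>\<open>\<rho>\<close> assigns tapes to variables. A quantifier always takes the new tape
  \<open>d\<close>, so that binding a variable again does not destroy its outer value. The value for
  \<open>SOAtom\<close> is arbitrary, as such atoms do not occur in first-order formulas.\<close>

fun compile :: "vocabulary \<Rightarrow> form \<Rightarrow> (nat \<Rightarrow> nat) \<Rightarrow> nat \<Rightarrow> tape_name prog" where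
  "compile \<sigma> (Eq s t) \<rho> d = test_eq (term_tape \<rho> s) (term_tape \<rho> t)"
| "compile \<sigma> (Le s t) \<rho> d = test_le (term_tape \<rho> s) (term_tape \<rho> t)"
| "compile \<sigma> (RelAtom i ts) \<rho> d = lookup \<sigma> i (map (term_tape \<rho>) ts)"
| "compile \<sigma> (SOAtom ts) \<rho> d = Nop"
| "compile \<sigma> (Neg \<phi>) \<rho> d =
     compile \<sigma> \<phi> \<rho> d ;; Cond FlagT (bit_sym True) (set_flag False) (set_flag True)"
| "compile \<sigma> (Conj \<phi> \<psi>) \<rho> d = junction True (compile \<sigma> \<phi> \<rho> d) (compile \<sigma> \<psi> \<rho> d)"
| "compile \<sigma> (Disj \<phi> \<psi>) \<rho> d = junction False (compile \<sigma> \<phi> \<rho> d) (compile \<sigma> \<psi> \<rho> d)"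
| "compile \<sigma> (Exists v \<phi>) \<rho> d = quantifier False d (compile \<sigma> \<phi> (\<rho>(v := d)) (Suc d))"
| "compile \<sigma> (Forall v \<phi>) \<rho> d = quantifier True d (compile \<sigma> \<phi> (\<rho>(v := d)) (Suc d))"

text \<open>By the bound on \<open>\<rho>\<close>, tape \<open>d\<close> belongs to \<open>v\<close>
  alone after the reassignment, so writing to it changes no other variable.\<close>

lemma env_upd:
  assumes "\<forall>v. \<rho> v < d"
  shows "(env A \<rho> e)(v := enumeration A ! i) = env A (\<rho>(v := d)) (e(d := i))"
  using assms by (auto simp: env_def fun_eq_iff)

lemma evaluates_lookup:
  assumes i: "i < length (rel_arities \<sigma>)" and ts: "length ts = rel_arities \<sigma> ! i"
  shows "evaluates \<sigma> (lookup \<sigma> i (map (term_tape \<rho>) ts)) d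
     (\<lambda>A e. map ((!) (enumeration A) \<circ> term_index \<sigma> A \<rho> e) ts \<in> rel_vals A ! i)"
proof -
  obtain q1 where q1: "\<And>N n s w p. n \<le> N \<Longrightarrow> (\<forall>j. s (LoopT j) = index_tape n 0) \<Longrightarrow>
      s InT = bits_tape w p \<Longrightarrow> runs (skips (take i (rel_arities \<sigma>))) s
      (s(InT := bits_tape w (p + sum_list (map (\<lambda>k. n ^ k) (take i (rel_arities \<sigma>)))))) (poly q1 N)"
    using runs_skips[of "take i (rel_arities \<sigma>)"] by blast
  have "\<forall>x \<in> set (map (term_tape \<rho>) ts). x \<noteq> InT \<and> (\<forall>j. x \<noteq> LoopT j)" by auto
  from runs_skip_to[OF this] obtain q2 where q2: "\<And>N n s w p ix. n \<le> N \<Longrightarrow>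
      (\<forall>j. s (LoopT j) = index_tape n 0) \<Longrightarrow> s InT = bits_tape w p \<Longrightarrow>
      (\<forall>x \<in> set (map (term_tape \<rho>) ts). s x = index_tape n (ix x) \<and> ix x < n) \<Longrightarrow>
      runs (skip_to (map (term_tape \<rho>) ts)) s
        (s(InT := bits_tape w (p + table_index n (map ix (map (term_tape \<rho>) ts))))) (poly q2 N)"
    by blast
  show ?thesis
  \<comment> \<open>The linear part collects \<open>2 * n + 3\<close> for the header, 2 for reading
    the bit, \<open>2 * N + 5\<close> for rewinding the input and 4 for the sequencing
    steps.\<close>
  proof (rule evaluatesI[where q = "q1 + q2 + [:14, 4:]"])
    fix A :: "'a ordered_struct" and r and e :: "nat \<Rightarrow> nat" and w
    assume A: "A \<in> structures \<sigma>" "\<forall>j. e j < size_of A" "\<forall>j\<ge>d. e j = 0"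
    let ?s = "\<lambda>r. store \<sigma> A (const_index \<sigma> A) r e w" and ?N = "length (enc_struct \<sigma> A)"
    let ?n = "size_of A" and ?w = "enc_struct \<sigma> A"
    let ?is = "map (term_index \<sigma> A \<rho> e) ts"
    let ?b = "map ((!) (enumeration A) \<circ> term_index \<sigma> A \<rho> e) ts \<in> rel_vals A ! i"
    let ?p1 = "Suc ?n + sum_list (map (\<lambda>k. ?n ^ k) (take i (rel_arities \<sigma>)))"
    let ?p2 = "?p1 + table_index ?n ?is"
    let ?at = "\<lambda>r p. (?s r)(InT := bits_tape ?w p)"
    have less: "\<forall>j \<in> set ?is. j < ?n" using term_index_less[OF A(1,2)] by auto
    have bit: "?p2 < ?N" "?w ! ?p2 = ?b"
      using relation_bit[OF A(1) i _ less] ts by (simp_all add: comp_def)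
    have 1: "runs seek_tables (?s r) (?at r (Suc ?n)) (2 * ?n + 3)"
      by (rule runs_seek_tables) (auto simp: enc_struct_tables)
    have 2: "runs (skips (take i (rel_arities \<sigma>))) (?at r (Suc ?n)) (?at r ?p1) (poly q1 ?N)"
      by (rule runs_weaken[OF q1[where N = ?N and p = "Suc ?n" and w = ?w]]) (auto simp: size_of_le)
    \<comment> \<open>\<open>skip_to\<close> speaks of tapes rather than terms, so the index is
      recovered from the name of the tape.\<close>
    define ix where "ix x = (case x of VarT j \<Rightarrow> e j | ConstT c \<Rightarrow> const_index \<sigma> A c | _ \<Rightarrow> 0)" for x
    have ix: "ix (term_tape \<rho> t) = term_index \<sigma> A \<rho> e t" for t by (cases t) (auto simp: ix_def)
    have 3: "runs (skip_to (map (term_tape \<rho>) ts)) (?at r ?p1) (?at r ?p2) (poly q2 ?N)"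
      by (rule runs_weaken[OF q2[where N = ?N and p = "?p1" and w = ?w and ix = ix]])
         (use term_index_less[OF A(1,2)] in \<open>auto simp: size_of_le ix comp_def\<close>)
    have 4: "runs (read_flag InT) (?at r ?p2) (?at ?b ?p2) 2"
      by (rule runs_weaken[OF runs_read_flag[where w = ?w and p = ?p2 and r = r]])
         (use bit in \<open>auto simp: fun_upd_twist[of InT FlagT]\<close>)
    have 5: "runs (rewind InT) (?at ?b ?p2) (?s ?b) (2 * ?N + 5)"
      by (rule runs_weaken[OF runs_rewind[OF _ _ order_refl, where p = ?p2 and w = ?w]])
         (use bit in \<open>auto simp: fun_eq_iff\<close>)
    show "runs (lookup \<sigma> i (map (term_tape \<rho>) ts)) (?s r) (?s ?b) (poly (q1 + q2 + [:14, 4:]) ?N)"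
      unfolding lookup_def
      by (rule runs_Seq[OF 1 runs_Seq[OF 2 runs_Seq[OF 3 runs_Seq[OF 4 5
              order_refl] order_refl] order_refl]])
         (use size_of_le[of A \<sigma>] in simp)
  qed
qed

lemma evaluates_compile:
  assumes "first_order_over \<sigma> \<phi>" "\<forall>v. \<rho> v < d"
  shows "evaluates \<sigma> (compile \<sigma> \<phi> \<rho> d) d
    (\<lambda>(A :: 'a ordered_struct) e. holds A X (env A \<rho> e) \<phi>)"
  using assms
proof (induction \<phi> arbitrary: \<rho> d)
  case (Eq s t)
  show ?case
  proof (rule evaluatesI[where q = "[:20, 8:]"])
    fix A :: "'a ordered_struct" and r and e :: "nat \<Rightarrow> nat" and w
    assume A: "A \<in> structures \<sigma>" "\<forall>j. e j < size_of A"
    let ?s = "\<lambda>r. store \<sigma> A (const_index \<sigma> A) r e w"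
    note less = term_index_less[OF A, of \<rho>]
    have "holds A X (env A \<rho> e) (Eq s t) \<longleftrightarrow> term_index \<sigma> A \<rho> e s = term_index \<sigma> A \<rho> e t"
      using Eq trm_val_env[OF A(1)] enumeration(2)[OF A(1)] less by (simp add: nth_eq_iff_index_eq)
    then show "runs (compile \<sigma> (Eq s t) \<rho> d) (?s r) (?s (holds A X (env A \<rho> e) (Eq s t)))
        (poly [:20, 8:] (length (enc_struct \<sigma> A)))"
      using runs_test_eq[of "?s r" "term_tape \<rho> s" "size_of A" "term_index \<sigma> A \<rho> e s"
          "term_tape \<rho> t" "term_index \<sigma> A \<rho> e t" r "length (enc_struct \<sigma> A)"] less size_of_le[of A \<sigma>]
        term_tape_eq[of \<rho> s t \<sigma> A e] by (simp add: algebra_simps)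
  qed
next
  case (Le s t)
  show ?case
  proof (rule evaluatesI[where q = "[:20, 11:]"])
    fix A :: "'a ordered_struct" and r and e :: "nat \<Rightarrow> nat" and w
    assume A: "A \<in> structures \<sigma>" "\<forall>j. e j < size_of A"
    let ?s = "\<lambda>r. store \<sigma> A (const_index \<sigma> A) r e w"
    note less = term_index_less[OF A, of \<rho>]
    have "holds A X (env A \<rho> e) (Le s t) \<longleftrightarrow> term_index \<sigma> A \<rho> e s \<le> term_index \<sigma> A \<rho> e t"
      using Le trm_val_env[OF A(1)] less enumeration_le_iff[OF A(1)] by simp
    then show "runs (compile \<sigma> (Le s t) \<rho> d) (?s r) (?s (holds A X (env A \<rho> e) (Le s t)))
        (poly [:20, 11:] (length (enc_struct \<sigma> A)))"
      using runs_test_le[of "?s r" "term_tape \<rho> s" "size_of A" "term_index \<sigma> A \<rho> e s"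
          "term_tape \<rho> t" "term_index \<sigma> A \<rho> e t" r "length (enc_struct \<sigma> A)"] less size_of_le[of A \<sigma>]
        term_tape_eq[of \<rho> s t \<sigma> A e] by (simp add: algebra_simps)
  qed
next
  case (RelAtom i ts)
  then have ev: "evaluates \<sigma> (lookup \<sigma> i (map (term_tape \<rho>) ts)) d
     (\<lambda>(A :: 'a ordered_struct) e. map ((!) (enumeration A) \<circ> term_index \<sigma> A \<rho> e) ts \<in> rel_vals A ! i)"
    by (intro evaluates_lookup) auto
  have eq: "map (trm_val A (env A \<rho> e)) ts = map ((!) (enumeration A) \<circ> term_index \<sigma> A \<rho> e) ts"
    if "A \<in> structures \<sigma>" for A :: "'a ordered_struct" and e
    using RelAtom.prems trm_val_env[OF that] by simp
  show ?case
    unfolding compile.simps by (rule evaluates_cong[OF ev]) (simp add: eq)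
next
  case (SOAtom ts)
  then show ?case by simp
next
  case (Neg \<phi>)
  then show ?case using evaluates_not[OF Neg.IH[of \<rho> d]] by simp
next
  case (Conj \<phi> \<psi>)
  then show ?case
    using evaluates_cong[OF evaluates_junction[OF Conj.IH(1)[of \<rho> d] Conj.IH(2)[of \<rho> d], of True]]
    by simp
next
  case (Disj \<phi> \<psi>)
  then show ?case
    using evaluates_cong[OF evaluates_junction[OF Disj.IH(1)[of \<rho> d] Disj.IH(2)[of \<rho> d], of False]]
    by simp
next
  case (Exists v \<phi>)
  have "evaluates \<sigma> (compile \<sigma> \<phi> (\<rho>(v := d)) (Suc d)) (Suc d)
    (\<lambda>(A :: 'a ordered_struct) e. holds A X (env A (\<rho>(v := d)) e) \<phi>)"
    using Exists.prems by (intro Exists.IH) (auto simp: less_Suc_eq)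
  note ev = evaluates_quantifier[OF this, of False]
  show ?case
    unfolding compile.simps
    by (rule evaluates_cong[OF ev])
       (auto simp: env_upd[OF Exists.prems(2), symmetric] enumeration(1)[symmetric] in_set_conv_nth
         Bex_def)
next
  case (Forall v \<phi>)
  have "evaluates \<sigma> (compile \<sigma> \<phi> (\<rho>(v := d)) (Suc d)) (Suc d)
    (\<lambda>(A :: 'a ordered_struct) e. holds A X (env A (\<rho>(v := d)) e) \<phi>)"
    using Forall.prems by (intro Forall.IH) (auto simp: less_Suc_eq)
  note ev = evaluates_quantifier[OF this, of True]
  show ?case
    unfolding compile.simps
    by (rule evaluates_cong[OF ev])
       (auto simp: env_upd[OF Forall.prems(2), symmetric] enumeration(1)[symmetric] in_set_conv_nth
         Ball_def)
qed


section \<open>Writing the formula\<close>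

text \<open>The flag is false before and after, so that every round of a loop starts in the same
  form of store. \<open>Z\<close> collects the variable tapes that must hold index 0: the scratch
  tapes of formula evaluation and the counters of the loops inside \<open>p\<close>.\<close>

definition emits :: "vocabulary \<Rightarrow> tape_name prog \<Rightarrow> nat set \<Rightarrow>
    ('a ordered_struct \<Rightarrow> (nat \<Rightarrow> nat) \<Rightarrow> bool list) \<Rightarrow> bool" where
  "emits \<sigma> p Z f \<longleftrightarrow> (\<exists>q. \<forall>A \<in> structures \<sigma>. \<forall>e w.
     (\<forall>j. e j < size_of A) \<and> (\<forall>j\<in>Z. e j = 0) \<longrightarrow>
     runs p (store \<sigma> A (const_index \<sigma> A) False e w)
       (store \<sigma> A (const_index \<sigma> A) False e (w @ f A e)) (poly q (length (enc_struct \<sigma> A))))"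

lemma emitsI:
  assumes "\<And>A e w. A \<in> structures \<sigma> \<Longrightarrow> (\<forall>j. e j < size_of A) \<Longrightarrow> (\<forall>j\<in>Z. e j = 0) \<Longrightarrow>
     runs p (store \<sigma> A (const_index \<sigma> A) False e w)
       (store \<sigma> A (const_index \<sigma> A) False e (w @ f A e)) (poly q (length (enc_struct \<sigma> A)))"
  shows "emits \<sigma> p Z f"
  unfolding emits_def using assms by blast

lemma emitsE:
  assumes "emits \<sigma> p Z f"
  obtains q where "\<And>A e w. A \<in> structures \<sigma> \<Longrightarrow> (\<forall>j. e j < size_of A) \<Longrightarrow> (\<forall>j\<in>Z. e j = 0) \<Longrightarrow>
     runs p (store \<sigma> A (const_index \<sigma> A) False e w)
       (store \<sigma> A (const_index \<sigma> A) False e (w @ f A e)) (poly q (length (enc_struct \<sigma> A)))"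
  using assms unfolding emits_def by blast

lemma emits_Nop: "emits \<sigma> Nop Z (\<lambda>A e. [])"
  by (rule emitsI[where q = "[:1:]"]) (simp add: runs_Nop)

lemma emits_Seq:
  assumes "emits \<sigma> p Z f" "emits \<sigma> p' Z f'"
  shows "emits \<sigma> (p ;; p') Z (\<lambda>A e. f A e @ f' A e)"
proof -
  obtain q where q: "\<And>A e w. A \<in> structures \<sigma> \<Longrightarrow> (\<forall>j. e j < size_of A) \<Longrightarrow> (\<forall>j\<in>Z. e j = 0) \<Longrightarrow>
     runs p (store \<sigma> A (const_index \<sigma> A) False e w)
       (store \<sigma> A (const_index \<sigma> A) False e (w @ f A e)) (poly q (length (enc_struct \<sigma> A)))"
    using assms(1) by (rule emitsE) blast
  obtain q' where q': "\<And>A e w. A \<in> structures \<sigma> \<Longrightarrow> (\<forall>j. e j < size_of A) \<Longrightarrow> (\<forall>j\<in>Z. e j = 0) \<Longrightarrow>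
     runs p' (store \<sigma> A (const_index \<sigma> A) False e w)
       (store \<sigma> A (const_index \<sigma> A) False e (w @ f' A e)) (poly q' (length (enc_struct \<sigma> A)))"
    using assms(2) by (rule emitsE) blast
  show ?thesis
    by (rule emitsI[where q = "q + q' + [:1:]"])
       (use runs_Seq[OF q q'] in \<open>simp flip: append_assoc\<close>)
qed

fun emit_word :: "tape_name \<Rightarrow> bool list \<Rightarrow> tape_name prog" where
  "emit_word x [] = Nop"
| "emit_word x (b # bs) = emit x b ;; emit_word x bs"

lemma runs_emit_word:
  assumes "s x = bits_tape w (length w)" "4 * length bs + 1 \<le> t"
  shows "runs (emit_word x bs) s (s(x := bits_tape (w @ bs) (length (w @ bs)))) t"
  using assms
proof (induction bs arbitrary: s w t)
  case Nil
  then show ?case using runs_Nop[of t s] by (simp add: fun_upd_idem)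
next
  case (Cons b bs)
  let ?s = "s(x := bits_tape (w @ [b]) (length (w @ [b])))"
  have "runs (emit_word x bs) ?s (?s(x := bits_tape ((w @ [b]) @ bs) (length ((w @ [b]) @ bs))))
      (4 * length bs + 1)"
    by (rule Cons.IH) auto
  then have "runs (emit_word x (b # bs)) s
      (?s(x := bits_tape ((w @ [b]) @ bs) (length ((w @ [b]) @ bs)))) t"
    unfolding emit_word.simps
    using Cons.prems by (intro runs_Seq[OF runs_emit]) auto
  then show ?case by (rule runs_weaken) (auto simp: fun_eq_iff)
qed

lemma emits_word: "emits \<sigma> (emit_word OutT bs) Z (\<lambda>A e. bs)"
  by (rule emitsI[where q = "[:4 * length bs + 1:]"])
     (rule runs_weaken[OF runs_emit_word], auto)

fun emit_indices :: "nat list \<Rightarrow> tape_name prog" where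
  "emit_indices [] = Nop"
| "emit_indices (d # ds) =
     sweep (VarT d) 0 (Cond (VarT d) (bit_sym True) (emit_word OutT [True, True])
       (emit_word OutT [False, False])) ;; emit_indices ds"

lemma double_bits_simps [simp]:
  "double_bits [] = []" "double_bits (b # w) = b # b # double_bits w"
  "double_bits (v @ w) = double_bits v @ double_bits w"
  by (simp_all add: double_bits_def)

lemma emits_indices:
  "emits \<sigma> (emit_indices ds) Z (\<lambda>A e. double_bits (concat (map (\<lambda>d. one_hot (size_of A) (e d)) ds)))"
proof (induction ds)
  case Nil
  then show ?case using emits_Nop by simp
next
  case (Cons d ds)
  let ?p = "Cond (VarT d) (bit_sym True) (emit_word OutT [True, True]) (emit_word OutT [False, False])"
  have "emits \<sigma> (sweep (VarT d) 0 ?p) Z (\<lambda>A e. double_bits (one_hot (size_of A) (e d)))"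
  \<comment> \<open>Two emitted bits take 9 steps and the test one more; a sweep adds 5 per cell and
    7 in all.\<close>
  proof (rule emitsI[where q = "[:7, 15:]"])
    fix A :: "'b ordered_struct" and e :: "nat \<Rightarrow> nat" and w
    assume A: "A \<in> structures \<sigma>"
    let ?N = "length (enc_struct \<sigma> A)"
    define h where "h = one_hot (size_of A) (e d)"
    define S where "S k = store \<sigma> A (const_index \<sigma> A) False e (w @ double_bits (take k h))" for k
    have "runs (sweep (VarT d) 0 ?p) (store \<sigma> A (const_index \<sigma> A) False e w)
        (store \<sigma> A (const_index \<sigma> A) False e (w @ double_bits h)) (?N * 15 + 7)"
    proof (rule runs_sweep_all[where S = S and w = h and n = "size_of A" and N = ?N and t = 10])
      fix k assume k: "k < size_of A"
      let ?s = "(S k)(VarT d := bits_tape h k)"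
      have t: "take (Suc k) h = take k h @ [h ! k]"
        using k by (simp add: h_def take_Suc_conv_app_nth)
      have S: "(S (Suc k))(VarT d := bits_tape h k) =
          ?s(OutT := bits_tape ((w @ double_bits (take k h)) @ [h ! k, h ! k])
            (length ((w @ double_bits (take k h)) @ [h ! k, h ! k])))"
        by (rule ext, rename_tac v, case_tac v) (simp_all add: S_def t)
      have "runs (emit_word OutT [h ! k, h ! k]) ?s ((S (Suc k))(VarT d := bits_tape h k)) 9"
        unfolding S by (rule runs_emit_word) (auto simp: S_def)
      then show "runs ?p ?s ((S (Suc k))(VarT d := bits_tape h k)) 10"
        by (intro runs_Cond[where t = 9])
           (use k in \<open>auto simp: scan_bits_tape h_def split: if_splits\<close>)
    next
      show "store \<sigma> A (const_index \<sigma> A) False e w = (S 0)(VarT d := bits_tape h 0)"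
        "store \<sigma> A (const_index \<sigma> A) False e (w @ double_bits h) =
          (S (size_of A))(VarT d := bits_tape h 0)"
        by (rule ext, rename_tac v, case_tac v; simp add: S_def h_def index_tape_def)+
    qed (use size_of_le[of A \<sigma>] in \<open>auto simp: h_def\<close>)
    then show "runs (sweep (VarT d) 0 ?p) (store \<sigma> A (const_index \<sigma> A) False e w)
        (store \<sigma> A (const_index \<sigma> A) False e (w @ double_bits (one_hot (size_of A) (e d))))
        (poly [:7, 15:] ?N)" by (simp add: h_def add.commute)
  qed
  from emits_Seq[OF this Cons] show ?case by simp
qed

text \<open>The flag is cleared before \<open>p'\<close> runs and is already false in the other
  branch, so both branches end in the store that \<open>emits\<close> asks for.\<close>

lemma emits_if:
  assumes "evaluates \<sigma> p d g" "emits \<sigma> p' Z f" "{d..} \<subseteq> Z"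
  shows "emits \<sigma> (p ;; Cond FlagT (bit_sym True) (set_flag False ;; p') Nop) Z
    (\<lambda>A e. if g A e then f A e else [])"
proof -
  obtain q where q: "\<And>A r e w. A \<in> structures \<sigma> \<Longrightarrow> (\<forall>j. e j < size_of A) \<Longrightarrow> (\<forall>j\<ge>d. e j = 0) \<Longrightarrow>
     runs p (store \<sigma> A (const_index \<sigma> A) r e w) (store \<sigma> A (const_index \<sigma> A) (g A e) e w)
       (poly q (length (enc_struct \<sigma> A)))" using assms(1) by (rule evaluatesE) blast
  obtain q' where q': "\<And>A e w. A \<in> structures \<sigma> \<Longrightarrow> (\<forall>j. e j < size_of A) \<Longrightarrow> (\<forall>j\<in>Z. e j = 0) \<Longrightarrow>
     runs p' (store \<sigma> A (const_index \<sigma> A) False e w)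
       (store \<sigma> A (const_index \<sigma> A) False e (w @ f A e)) (poly q' (length (enc_struct \<sigma> A)))"
    using assms(2) by (rule emitsE) blast
  show ?thesis
  proof (rule emitsI[where q = "q + q' + [:5:]"])
    fix A :: "'a ordered_struct" and e :: "nat \<Rightarrow> nat" and w
    assume A: "A \<in> structures \<sigma>" "\<forall>j. e j < size_of A" "\<forall>j\<in>Z. e j = 0"
    let ?s = "\<lambda>r w. store \<sigma> A (const_index \<sigma> A) r e w" and ?N = "length (enc_struct \<sigma> A)"
    let ?w = "w @ (if g A e then f A e else [])"
    have 1: "runs p (?s False w) (?s (g A e) w) (poly q ?N)" using q A assms(3) by blast
    have "runs (Cond FlagT (bit_sym True) (set_flag False ;; p') Nop) (?s (g A e) w) (?s False ?w)
        (poly q' ?N + 3)"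
    proof (rule runs_Cond[where t = "poly q' ?N + 2"])
      assume "scan (?s (g A e) w FlagT) = bit_sym True"
      then have g: "g A e" by (simp add: scan_bits_tape)
      have "runs (set_flag False) (?s (g A e) w) (?s False w) 1"
        using runs_set_flag[of "?s (g A e) w" "g A e" 1 False] by simp
      then show "runs (set_flag False ;; p') (?s (g A e) w) (?s False ?w) (poly q' ?N + 2)"
        using runs_Seq[OF _ q'[OF A]] g by simp
    next
      assume "scan (?s (g A e) w FlagT) \<noteq> bit_sym True"
      then show "runs Nop (?s (g A e) w) (?s False ?w) (poly q' ?N + 2)"
        by (auto simp: scan_bits_tape intro: runs_Nop)
    qed simp
    then show "runs (p ;; Cond FlagT (bit_sym True) (set_flag False ;; p') Nop) (?s False w) (?s False ?w)
        (poly (q + q' + [:5:]) ?N)" by (intro runs_Seq[OF 1]) auto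
  qed
qed

text \<open>Inside the body tape \<open>d\<close> takes all values, so the body must not rely on it
  being 0; the loop as a whole does start from 0, and \<open>d\<close> joins
  \<open>Z\<close>.\<close>

lemma emits_for_each:
  assumes "emits \<sigma> p Z f" "d \<notin> Z"
  shows "emits \<sigma> (for_each (VarT d) p) (insert d Z)
    (\<lambda>A e. concat (map (\<lambda>i. f A (e(d := i))) [0..<size_of A]))"
proof -
  obtain q where q: "\<And>A e w. A \<in> structures \<sigma> \<Longrightarrow> (\<forall>j. e j < size_of A) \<Longrightarrow> (\<forall>j\<in>Z. e j = 0) \<Longrightarrow>
     runs p (store \<sigma> A (const_index \<sigma> A) False e w)
       (store \<sigma> A (const_index \<sigma> A) False e (w @ f A e)) (poly q (length (enc_struct \<sigma> A)))"
    using assms(1) by (rule emitsE) blast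
  show ?thesis
  proof (rule emitsI[where q = "[:0, 1:] * (q + [:30, 4:]) + [:20:]"])
    fix A :: "'a ordered_struct" and e :: "nat \<Rightarrow> nat" and w
    assume A: "A \<in> structures \<sigma>" "\<forall>j. e j < size_of A" "\<forall>j\<in>insert d Z. e j = 0"
    let ?N = "length (enc_struct \<sigma> A)" and ?st = "store \<sigma> A (const_index \<sigma> A) False"
    let ?out = "\<lambda>k. w @ concat (map (\<lambda>i. f A (e(d := i))) [0..<k])"
    have e: "e(d := 0) = e" using A(3) by (simp add: fun_upd_idem)
    show "runs (for_each (VarT d) p) (?st e w) (?st e (?out (size_of A)))
        (poly ([:0, 1:] * (q + [:30, 4:]) + [:20:]) ?N)"
    proof (rule runs_for_each[where S = "\<lambda>k. ?st e (?out k)" and n = "size_of A" and N = ?N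
          and t = "poly q ?N"])
      fix i assume i: "i < size_of A"
      have "runs p (?st (e(d := i)) (?out i)) (?st (e(d := i)) (?out (Suc i))) (poly q ?N)"
        using q[OF A(1), of "e(d := i)" "?out i"] A assms(2) i by simp
      then show "runs p ((?st e (?out i))(VarT d := index_tape (size_of A) i))
          ((?st e (?out (Suc i)))(VarT d := index_tape (size_of A) i)) (poly q ?N)" by simp
    next
      show "0 < size_of A" "size_of A \<le> ?N" using size_of_pos[OF A(1)] size_of_le by auto
    qed (simp_all add: e algebra_simps)
  qed
qed

fun updates :: "('k \<Rightarrow> 'v) \<Rightarrow> 'k list \<Rightarrow> 'v list \<Rightarrow> 'k \<Rightarrow> 'v" where
  "updates e (k # ks) (v # vs) = updates (e(k := v)) ks vs"
| "updates e _ _ = e"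

definition for_tuples :: "nat list \<Rightarrow> tape_name prog \<Rightarrow> tape_name prog" where
  "for_tuples ds p = foldr (\<lambda>d. for_each (VarT d)) ds p"

definition index_tuples :: "nat \<Rightarrow> nat \<Rightarrow> nat list list" where
  "index_tuples n k = product_lists (replicate k [0..<n])"

lemma concat_map_concat: "concat (map (\<lambda>x. concat (f x)) xs) = concat (concat (map f xs))"
  by (induction xs) auto

text \<open>The outermost loop runs over the first component, so tuples come in the order of
  \<open>product_lists\<close>. The output thus matches the encoding bit by bit and not only up to
  the order of clauses.\<close>

lemma emits_for_tuples:
  assumes "emits \<sigma> p Z f" "distinct ds" "set ds \<inter> Z = {}"
  shows "emits \<sigma> (for_tuples ds p) (set ds \<union> Z)
    (\<lambda>A e. concat (map (\<lambda>is. f A (updates e ds is)) (index_tuples (size_of A) (length ds))))"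
  using assms
proof (induction ds)
  case Nil
  then show ?case by (simp add: for_tuples_def index_tuples_def)
next
  case (Cons d ds)
  then have "emits \<sigma> (for_tuples ds p) (set ds \<union> Z)
    (\<lambda>A e. concat (map (\<lambda>is. f A (updates e ds is)) (index_tuples (size_of A) (length ds))))"
    by simp
  from emits_for_each[OF this, of d] Cons.prems show ?case
    by (simp add: for_tuples_def index_tuples_def map_concat comp_def concat_map_concat)
qed


section \<open>Initialization\<close>

text \<open>The header of the input is the size in unary, so one cell is written per header cell;
  the last action makes the string index 0.\<close>

definition fill :: "tape_name \<Rightarrow> tape_name prog" where
  "fill x = sweep InT (bit_sym False) (emit x False) ;; rewind x ;; Wr x (bit_sym True)"

lemma runs_fill:
  assumes "s InT = bits_tape w 0" "w = replicate n True @ [False] @ v" "s x = bits_tape [] 0"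
    "x \<noteq> InT" "0 < n" "n \<le> N"
  shows "runs (fill x) s (s(x := index_tape n 0)) (10 * N + 20)"
proof -
  let ?S = "\<lambda>k. s(x := bits_tape (replicate k False) k)"
  have 1: "runs (sweep InT (bit_sym False) (emit x False)) s (?S n) (N * 8 + 7)"
  proof (rule runs_sweep[where S = ?S and w = w and k = n and t = 3 and N = N])
    fix k
    show "runs (emit x False) ((?S k)(InT := bits_tape w k)) ((?S (Suc k))(InT := bits_tape w k)) 3"
      by (rule runs_weaken[OF runs_emit[where w = "replicate k False"]])
         (use assms in \<open>auto simp: fun_eq_iff replicate_append_same\<close>)
  qed (use assms in \<open>auto simp: scan_bits_tape nth_append fun_eq_iff\<close>)
  have 2: "runs (rewind x) (?S n) (s(x := bits_tape (replicate n False) 0)) (2 * n + 5)"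
    by (rule runs_weaken[OF runs_rewind[OF _ _ order_refl, where p = n and w = "replicate n False"]])
       auto
  have h: "(replicate n False)[0 := True] = one_hot n 0"
    by (auto intro!: nth_equalityI simp: nth_list_update split: if_splits)
  have 3: "runs (Wr x (bit_sym True)) (s(x := bits_tape (replicate n False) 0)) (s(x := index_tape n 0)) 1"
    by (rule runs_weaken[OF runs_write[where p = 0 and w = "replicate n False"]])
       (use assms(5) h in \<open>auto simp: index_tape_def\<close>)
  show ?thesis
    unfolding fill_def using assms(6) by (intro runs_Seq[OF 1 runs_Seq[OF 2 3 order_refl]]) simp
qed

fun fills :: "tape_name list \<Rightarrow> tape_name prog" where
  "fills [] = Nop"
| "fills (x # xs) = fill x ;; fills xs"

lemma runs_fills:
  assumes "s InT = bits_tape w 0" "w = replicate n True @ [False] @ v"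
    "\<forall>x \<in> set xs. s x = bits_tape [] 0" "distinct xs" "InT \<notin> set xs" "0 < n" "n \<le> N"
  shows "runs (fills xs) s (\<lambda>x. if x \<in> set xs then index_tape n 0 else s x)
    (length xs * (10 * N + 21) + 1)"
  using assms
proof (induction xs arbitrary: s)
  case Nil
  then show ?case using runs_Nop[of 1 s] by simp
next
  case (Cons x xs)
  let ?s = "s(x := index_tape n 0)"
  have 1: "runs (fill x) s ?s (10 * N + 20)"
    by (rule runs_fill) (use Cons.prems in auto)
  have "runs (fills xs) ?s (\<lambda>x. if x \<in> set xs then index_tape n 0 else ?s x)
    (length xs * (10 * N + 21) + 1)"
    by (rule Cons.IH) (use Cons.prems in auto)
  then show ?case
    unfolding fills.simps
    by (intro runs_weaken[OF runs_Seq[OF 1 _ order_refl]]) (auto simp: fun_eq_iff)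
qed

text \<open>No marker delimits a table within the input, so the ruler \<open>LoopT 0\<close>
  measures the cells to be copied. The arities 1 skip the tables of the preceding constants.\<close>

definition copy_constant :: "vocabulary \<Rightarrow> nat \<Rightarrow> tape_name prog" where
  "copy_constant \<sigma> c = seek_tables ;; skips (rel_arities \<sigma> @ replicate c 1) ;;
     sweep (LoopT 0) 0
       (Cond InT (bit_sym True) (Wr (ConstT c) (bit_sym True)) (Wr (ConstT c) (bit_sym False)) ;;
        Mv (ConstT c) MoveRight ;; Mv InT MoveRight) ;;
     rewind (ConstT c) ;; rewind InT"

lemma runs_copy_constant:
  assumes c: "c < const_count \<sigma>"
  shows "\<exists>q. \<forall>(A :: 'a ordered_struct) \<in> structures \<sigma>. \<forall>ci r e w. ci c = 0 \<longrightarrow>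
    runs (copy_constant \<sigma> c) (store \<sigma> A ci r e w) (store \<sigma> A (ci(c := const_index \<sigma> A c)) r e w)
      (poly q (length (enc_struct \<sigma> A)))"
proof -
  let ?ks = "rel_arities \<sigma> @ replicate c 1"
  obtain q1 where q1: "\<And>N n s w p. n \<le> N \<Longrightarrow> (\<forall>j. s (LoopT j) = index_tape n 0) \<Longrightarrow>
      s InT = bits_tape w p \<Longrightarrow> runs (skips ?ks) s
      (s(InT := bits_tape w (p + sum_list (map (\<lambda>k. n ^ k) ?ks)))) (poly q1 N)"
    using runs_skips[of ?ks] by blast
  have "runs (copy_constant \<sigma> c) (store \<sigma> A ci r e w) (store \<sigma> A (ci(c := const_index \<sigma> A c)) r e w)
      (poly (q1 + [:24, 18:]) (length (enc_struct \<sigma> A)))"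
    if A: "A \<in> structures \<sigma>" and ci: "ci c = 0" for A :: "'a ordered_struct" and ci r e w
  proof -
    let ?s = "store \<sigma> A ci r e w" and ?N = "length (enc_struct \<sigma> A)" and ?n = "size_of A"
    let ?w = "enc_struct \<sigma> A"
    let ?p = "Suc ?n + sum_list (map (\<lambda>k. ?n ^ k) ?ks)"
    define h where "h = one_hot ?n (const_index \<sigma> A c)"
    \<comment> \<open>The tape during copying: \<open>k\<close> cells are final, the others still
      stem from the initial index 0.\<close>
    define g where "g k = take k h @ drop k (one_hot ?n 0)" for k
    define S where "S k = ?s(InT := bits_tape ?w (?p + k), ConstT c := bits_tape (g k) k)" for k
    have g: "length (g k) = ?n" "k < ?n \<Longrightarrow> (g k)[k := h ! k] = g (Suc k)" "g ?n = h" "g 0 = one_hot ?n 0"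
      for k
      by (auto simp: g_def h_def list_update_append take_Suc_conv_app_nth min_def
          simp flip: Cons_nth_drop_Suc split: nat.split)
    have n: "?n \<le> ?N" by (rule size_of_le)
    have bit: "?p + k < ?N" "?w ! (?p + k) = h ! k" if "k < ?n" for k
      using constant_bit[OF A c that] that by (auto simp: h_def)
    have 1: "runs seek_tables ?s (?s(InT := bits_tape ?w (Suc ?n))) (2 * ?n + 3)"
      by (rule runs_seek_tables) (auto simp: enc_struct_tables)
    have 2: "runs (skips ?ks) (?s(InT := bits_tape ?w (Suc ?n))) (S 0) (poly q1 ?N)"
      by (rule runs_weaken[OF q1[where N = ?N and p = "Suc ?n" and w = ?w and n = ?n]])
         (use n ci in \<open>auto simp: S_def g fun_eq_iff index_tape_def\<close>)
    have 3: "runs (sweep (LoopT 0) 0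
       (Cond InT (bit_sym True) (Wr (ConstT c) (bit_sym True)) (Wr (ConstT c) (bit_sym False)) ;;
        Mv (ConstT c) MoveRight ;; Mv InT MoveRight)) (S 0) (S ?n) (?N * 11 + 7)"
    proof (rule runs_sweep_all[where S = S and w = "one_hot ?n 0" and n = ?n and N = ?N and t = 6])
      fix k assume k: "k < ?n"
      let ?l = "bits_tape (one_hot ?n 0) k"
      let ?a = "(S k)(LoopT 0 := ?l)"
      let ?b = "?a(ConstT c := bits_tape (g (Suc k)) k)"
      let ?c = "?b(ConstT c := bits_tape (g (Suc k)) (Suc k))"
      have wr: "runs (Wr (ConstT c) (bit_sym b)) ?a ?b 1" if "b = h ! k" for b
        by (rule runs_weaken[OF runs_write[where w = "g k" and p = k]])
           (use that k g in \<open>auto simp: S_def\<close>)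
      have a: "runs (Cond InT (bit_sym True) (Wr (ConstT c) (bit_sym True)) (Wr (ConstT c) (bit_sym False))) ?a ?b 2"
        by (rule runs_Cond[where t = 1])
           (use wr bit[OF k] in \<open>auto simp: S_def scan_bits_tape\<close>)
      have b: "runs (Mv (ConstT c) MoveRight) ?b ?c 1"
        by (rule runs_weaken[OF runs_right]) auto
      have c: "runs (Mv InT MoveRight) ?c ((S (Suc k))(LoopT 0 := ?l)) 1"
        by (rule runs_weaken[OF runs_right[where w = ?w and p = "?p + k"]])
           (auto simp: S_def fun_eq_iff)
      show "runs (Cond InT (bit_sym True) (Wr (ConstT c) (bit_sym True)) (Wr (ConstT c) (bit_sym False)) ;;
        Mv (ConstT c) MoveRight ;; Mv InT MoveRight) ?a ((S (Suc k))(LoopT 0 := ?l)) 6"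
        by (rule runs_Seq[OF a runs_Seq[OF b c order_refl]]) simp
    qed (use n in \<open>auto simp: S_def fun_eq_iff index_tape_def\<close>)
    let ?d = "(S ?n)(ConstT c := index_tape ?n (const_index \<sigma> A c))"
    have 4: "runs (rewind (ConstT c)) (S ?n) ?d (2 * ?n + 5)"
      by (rule runs_weaken[OF runs_rewind[OF _ _ order_refl, where p = ?n and w = h]])
         (auto simp: S_def g h_def index_tape_def)
    \<comment> \<open>Rewinding requires the head to be at most at the end of the input. The last
      cell read lies inside the input, and it exists because the universe is nonempty.\<close>
    have "?p + (?n - 1) < ?N" using size_of_pos[OF A] by (intro bit(1)) simp
    then have p: "?p + ?n \<le> ?N" by linarith
    have 5: "runs (rewind InT) ?d (store \<sigma> A (ci(c := const_index \<sigma> A c)) r e w) (2 * ?N + 5)"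
      by (rule runs_weaken[OF runs_rewind[OF _ _ order_refl, where p = "?p + ?n" and w = ?w]])
         (use p in \<open>auto simp: S_def intro!: store_eqI\<close>,
          (rename_tac x, case_tac x; simp)?)
    show ?thesis
      unfolding copy_constant_def
      by (rule runs_Seq[OF 1 runs_Seq[OF 2 runs_Seq[OF 3 runs_Seq[OF 4 5
              order_refl] order_refl] order_refl]]) (use n in simp)
  qed
  then show ?thesis by blast
qed

fun copy_constants :: "vocabulary \<Rightarrow> nat list \<Rightarrow> tape_name prog" where
  "copy_constants \<sigma> [] = Nop"
| "copy_constants \<sigma> (c # cs) = copy_constant \<sigma> c ;; copy_constants \<sigma> cs"

lemma runs_copy_constants:
  assumes "\<forall>c \<in> set cs. c < const_count \<sigma>" "distinct cs"
  shows "\<exists>q. \<forall>(A :: 'a ordered_struct) \<in> structures \<sigma>. \<forall>ci r e w. (\<forall>c \<in> set cs. ci c = 0) \<longrightarrow>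
    runs (copy_constants \<sigma> cs) (store \<sigma> A ci r e w)
      (store \<sigma> A (\<lambda>c. if c \<in> set cs then const_index \<sigma> A c else ci c) r e w)
      (poly q (length (enc_struct \<sigma> A)))"
  using assms
proof (induction cs)
  case Nil
  show ?case by (rule exI[of _ "[:1:]"]) (simp add: runs_Nop)
next
  case (Cons c cs)
  obtain q1 where q1: "\<And>(A :: 'a ordered_struct) ci r e w. A \<in> structures \<sigma> \<Longrightarrow> ci c = 0 \<Longrightarrow>
    runs (copy_constant \<sigma> c) (store \<sigma> A ci r e w) (store \<sigma> A (ci(c := const_index \<sigma> A c)) r e w)
      (poly q1 (length (enc_struct \<sigma> A)))"
    using runs_copy_constant[of c \<sigma>] Cons.prems(1) by (meson list.set_intros(1))
  obtain q2 where q2: "\<And>(A :: 'a ordered_struct) ci r e w. A \<in> structures \<sigma> \<Longrightarrow>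
    (\<forall>c \<in> set cs. ci c = 0) \<Longrightarrow> runs (copy_constants \<sigma> cs) (store \<sigma> A ci r e w)
      (store \<sigma> A (\<lambda>c. if c \<in> set cs then const_index \<sigma> A c else ci c) r e w)
      (poly q2 (length (enc_struct \<sigma> A)))"
    using Cons.IH Cons.prems by (meson distinct.simps(2) list.set_intros(2))
  have "runs (copy_constants \<sigma> (c # cs)) (store \<sigma> A ci r e w)
      (store \<sigma> A (\<lambda>d. if d \<in> set (c # cs) then const_index \<sigma> A d else ci d) r e w)
      (poly (q1 + q2 + [:1:]) (length (enc_struct \<sigma> A)))"
    if A: "A \<in> structures \<sigma>" and ci: "\<forall>c \<in> set (c # cs). ci c = 0"
    for A :: "'a ordered_struct" and ci r e w
  proof -
    let ?ci = "ci(c := const_index \<sigma> A c)"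
    have "(\<lambda>d. if d \<in> set cs then const_index \<sigma> A d else ?ci d) =
        (\<lambda>d. if d \<in> set (c # cs) then const_index \<sigma> A d else ci d)" by auto
    then show ?thesis
      using runs_Seq[OF q1[OF A, of ci] q2[OF A, of ?ci]] ci Cons.prems(2) by simp
  qed
  then show ?case by blast
qed


section \<open>The reduction\<close>

definition bin_value :: "bool list \<Rightarrow> nat" where
  "bin_value bs = foldl (\<lambda>a b. 2 * a + of_bool b) 0 bs"

text \<open>Binary representations have no leading zeros; the leading \<open>True\<close> guarantees
  this for every word \<open>bs\<close>, so each such word is the representation of a
  number.\<close>

lemma enc_nat_bin_value: "enc_nat (bin_value (True # bs)) = True # bs"
proof (induction bs rule: rev_induct)
  case Nil
  show ?case by (simp add: bin_value_def enc_nat.simps)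
next
  case (snoc b bs)
  let ?v = "bin_value (True # bs)"
  have v: "?v \<noteq> 0"
  proof
    assume "?v = 0"
    then show False using snoc by (simp add: enc_nat.simps)
  qed
  have "bin_value (True # bs @ [b]) = 2 * ?v + of_bool b" by (simp add: bin_value_def)
  then show ?case using snoc v by (subst enc_nat.simps) auto
qed

text \<open>The number itself is exponentially large, but its binary representation can be copied from
  the tapes.\<close>

definition tuple_var :: "nat \<Rightarrow> nat list \<Rightarrow> nat" where
  "tuple_var n is = bin_value (True # concat (map (one_hot n) is))"

lemma set_index_tuples: "set (index_tuples n k) = {is. length is = k \<and> set is \<subseteq> {..<n}}"
proof -
  have "list_all2 P xs (replicate k y) \<longleftrightarrow> length xs = k \<and> (\<forall>x \<in> set xs. P x y)"
    for P :: "nat \<Rightarrow> nat list \<Rightarrow> bool" and xs y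
    by (auto simp: list_all2_conv_all_nth all_set_conv_all_nth)
  then show ?thesis by (auto simp: index_tuples_def product_lists_set)
qed

text \<open>The representation gives back the concatenated word; its blocks all have length
  \<open>n\<close>, so it splits uniquely, and a block determines an index below
  \<open>n\<close>.\<close>

lemma inj_on_tuple_var: "inj_on (tuple_var n) (set (index_tuples n k))"
proof (rule inj_onI)
  fix c c'
  assume c: "c \<in> set (index_tuples n k)" "c' \<in> set (index_tuples n k)"
    and eq: "tuple_var n c = tuple_var n c'"
  have "concat (map (one_hot n) c) = concat (map (one_hot n) c')"
    using arg_cong[OF eq, of enc_nat] by (simp add: tuple_var_def enc_nat_bin_value)
  moreover have "length c = length c'" using c by (simp add: set_index_tuples)
  ultimately have hot: "map (one_hot n) c = map (one_hot n) c'"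
    by (intro concat_injective) (auto simp: in_set_zip)
  have "inj_on (one_hot n) {..<n}"
  proof (rule inj_onI)
    fix i j assume "i \<in> {..<n}" "j \<in> {..<n}" "one_hot n i = one_hot n j"
    then show "i = j" using one_hot_nth[of i n i] one_hot_nth[of i n j] by simp
  qed
  then show "c = c'"
    using hot c
    by (intro map_inj_on[of "one_hot n" c c'])
       (auto simp: set_index_tuples intro: inj_on_subset[where A = "{..<n}"])
qed

section \<open>The monotone formula and its satisfying assignments\<close>

definition reduction_clause :: "nat \<Rightarrow> nat list list \<Rightarrow> literal list" where
  "reduction_clause n cs = map (\<lambda>c. PosLit (tuple_var n c)) cs"

text \<open>The second clause of every pair is implied by the first one. It makes every variable occur.\<close>

definition reduction_cnf :: "nat \<Rightarrow> nat \<Rightarrow> nat \<Rightarrow> (nat list \<Rightarrow> nat list \<Rightarrow> bool) \<Rightarrow> cnf" where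
  "reduction_cnf n m k H = concat (map (\<lambda>b.
     [reduction_clause n (filter (H b) (index_tuples n k)),
      reduction_clause n (filter (H b) (index_tuples n k) @ index_tuples n k)]) (index_tuples n m))"

text \<open>Carries a count of sets along an injection on their elements. It serves twice, for sets
  of propositional variables and for interpretations of \<open>X\<close>, both compared with sets of
  index tuples.\<close>

lemma card_subsets_image:
  assumes "inj_on f J"
  shows "card {X. X \<subseteq> f ` J \<and> P X} = card {Y. Y \<subseteq> J \<and> P (f ` Y)}"
proof -
  have "{X. X \<subseteq> f ` J \<and> P X} = image f ` {Y. Y \<subseteq> J \<and> P (f ` Y)}"
    by (auto simp: subset_image_iff)
  moreover have "inj_on (image f) {Y. Y \<subseteq> J \<and> P (f ` Y)}"
    by (rule inj_on_subset[OF inj_on_image_Pow[OF assms]]) auto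
  ultimately show ?thesis by (simp add: card_image)
qed

lemma index_tuples_nonempty: "0 < n \<Longrightarrow> index_tuples n m \<noteq> []"
proof -
  assume "0 < n"
  then have "replicate m 0 \<in> set (index_tuples n m)" by (auto simp: set_index_tuples)
  then show ?thesis by auto
qed

text \<open>The occurring variables are exactly the names of the \<open>k\<close>-tuples. By
  injectivity an assignment is the image of a unique set \<open>Y\<close> of tuples, and truth of a
  variable is membership in \<open>Y\<close>. Any relation \<open>H\<close> will do; the sentence
  enters later.\<close>

lemma sharp_sat_reduction_cnf:
  assumes "0 < n"
  shows "sharp_sat (reduction_cnf n m k H) = card {Y. Y \<subseteq> set (index_tuples n k) \<and>
    (\<forall>b \<in> set (index_tuples n m). \<exists>c \<in> Y. H b c)}"
proof -
  let ?J = "set (index_tuples n k)" and ?I = "set (index_tuples n m)"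
  let ?F = "reduction_cnf n m k H"
  have vars: "cnf_vars ?F = tuple_var n ` ?J"
  proof -
    have "lit_var ` set (reduction_clause n cs) = tuple_var n ` set cs" for cs
      by (simp add: reduction_clause_def image_image)
    note lits = this
    have F: "set ?F = (\<Union>b \<in> ?I. {reduction_clause n (filter (H b) (index_tuples n k)),
        reduction_clause n (filter (H b) (index_tuples n k) @ index_tuples n k)})"
      by (simp add: reduction_cnf_def)
    have UN: "\<Union> (g ` (\<Union>b \<in> I. {x b, y b})) = (\<Union>b \<in> I. g (x b) \<union> g (y b))"
      for g :: "literal list \<Rightarrow> nat set" and x y and I :: "nat list set"
      by auto
    have "cnf_vars ?F = (\<Union>b \<in> ?I. tuple_var n ` {c \<in> ?J. H b c} \<union>
        tuple_var n ` ({c \<in> ?J. H b c} \<union> ?J))"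
      unfolding cnf_vars_def F UN lits by simp
    also have "\<dots> = (\<Union>b \<in> ?I. tuple_var n ` ?J)" by (intro SUP_cong refl) auto
    \<comment> \<open>At least one padded clause must exist. Since \<open>0 < n\<close>, there is a
      tuple \<open>b\<close>, and for \<open>m = 0\<close> it is the empty one.\<close>
    also have "\<dots> = tuple_var n ` ?J"
      using index_tuples_nonempty[OF assms, of m] by simp
    finally show ?thesis .
  qed
  have sat: "satisfies (tuple_var n ` Y) ?F \<longleftrightarrow> (\<forall>b \<in> ?I. \<exists>c \<in> Y. H b c)" if Y: "Y \<subseteq> ?J" for Y
  proof -
    have mem: "tuple_var n c \<in> tuple_var n ` Y \<longleftrightarrow> c \<in> Y" if "c \<in> ?J" for c
      using inj_on_image_mem_iff[OF inj_on_tuple_var that Y] .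
    have "satisfies (tuple_var n ` Y) ?F \<longleftrightarrow>
        (\<forall>b \<in> ?I. \<exists>c \<in> ?J. H b c \<and> tuple_var n c \<in> tuple_var n ` Y)"
    proof -
      have "(\<exists>l \<in> set (reduction_clause n cs). lit_true S l) \<longleftrightarrow> (\<exists>c \<in> set cs. tuple_var n c \<in> S)"
        for cs S by (simp add: reduction_clause_def)
      then show ?thesis by (simp add: satisfies_def reduction_cnf_def) blast
    qed
    also have "\<dots> \<longleftrightarrow> (\<forall>b \<in> ?I. \<exists>c \<in> Y. H b c)" using mem Y by blast
    finally show ?thesis .
  qed
  have "sharp_sat ?F = card {Y. Y \<subseteq> ?J \<and> satisfies (tuple_var n ` Y) ?F}"
    unfolding sharp_sat_def vars by (rule card_subsets_image[OF inj_on_tuple_var])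
  also have "{Y. Y \<subseteq> ?J \<and> satisfies (tuple_var n ` Y) ?F} =
      {Y. Y \<subseteq> ?J \<and> (\<forall>b \<in> ?I. \<exists>c \<in> Y. H b c)}" using sat by blast
  finally show ?thesis .
qed

section \<open>Semantics of the quantifier prefix in terms of tuples\<close>

lemma updates_notin: "k \<notin> set ks \<Longrightarrow> updates e ks vs k = e k"
  by (induction e ks vs rule: updates.induct) auto

lemma map_updates: "distinct ks \<Longrightarrow> length ks = length vs \<Longrightarrow> map (updates e ks vs) ks = vs"
  by (induction e ks vs rule: updates.induct) (auto simp: updates_notin)

lemma updates_append:
  "length ks = length vs \<Longrightarrow> updates e (ks @ ks') (vs @ vs') = updates (updates e ks vs) ks' vs'"
  by (induction e ks vs rule: updates.induct) auto

lemma updates_nth: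
  assumes "distinct ks" "length ks = length vs" "i < length ks"
  shows "updates e ks vs (ks ! i) = vs ! i"
  using arg_cong[OF map_updates[OF assms(1,2), of e], of "\<lambda>xs. xs ! i"] assms(3) by simp

lemma Ball_tuples_Suc:
  "(\<forall>b \<in> tuples U (Suc k). P b) \<longleftrightarrow> (\<forall>a \<in> U. \<forall>b \<in> tuples U k. P (a # b))"
proof
  assume *: "\<forall>b \<in> tuples U (Suc k). P b"
  show "\<forall>a \<in> U. \<forall>b \<in> tuples U k. P (a # b)"
    using * by (auto simp: tuples_def)
next
  assume *: "\<forall>a \<in> U. \<forall>b \<in> tuples U k. P (a # b)"
  show "\<forall>b \<in> tuples U (Suc k). P b"
    using * by (auto simp: tuples_def length_Suc_conv)
qed

lemma Bex_tuples_Suc: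
  "(\<exists>b \<in> tuples U (Suc k). P b) \<longleftrightarrow> (\<exists>a \<in> U. \<exists>b \<in> tuples U k. P (a # b))"
  using Ball_tuples_Suc[of U k "\<lambda>b. \<not> P b"] by blast

lemma holds_foldr_Forall:
  "holds A X e (foldr Forall ys \<psi>) \<longleftrightarrow>
    (\<forall>b \<in> tuples (universe A) (length ys). holds A X (updates e ys b) \<psi>)"
proof (induction ys arbitrary: e)
  case Nil
  show ?case by (auto simp: tuples_def)
next
  case (Cons y ys)
  then show ?case by (simp add: Ball_tuples_Suc fun_upd_def)
qed

lemma holds_foldr_Exists:
  "holds A X e (foldr Exists ys \<psi>) \<longleftrightarrow>
    (\<exists>b \<in> tuples (universe A) (length ys). holds A X (updates e ys b) \<psi>)"
proof (induction ys arbitrary: e)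
  case Nil
  show ?case by (auto simp: tuples_def)
next
  case (Cons y ys)
  then show ?case by (simp add: Bex_tuples_Suc fun_upd_def)
qed

lemma trm_val_cong: "\<forall>v \<in> trm_vars t. e v = e' v \<Longrightarrow> trm_val A e t = trm_val A e' t"
  by (cases t) auto

text \<open>The interpretation of the second-order variable may change as well, which allows the
  condition on the tuples to be evaluated with the empty set.\<close>

lemma holds_cong:
  assumes "first_order_over \<sigma> \<phi>" "\<forall>v \<in> free_vars \<phi>. e v = e' v"
  shows "holds A X e \<phi> = holds A Y e' \<phi>"
  using assms
proof (induction \<phi> arbitrary: e e')
  case (Eq s t)
  then show ?case using trm_val_cong[of s e e' A] trm_val_cong[of t e e' A] by simp
next
  case (Le s t)
  then show ?case using trm_val_cong[of s e e' A] trm_val_cong[of t e e' A] by simp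
next
  case (RelAtom i ts)
  then have "map (trm_val A e) ts = map (trm_val A e') ts"
    by (intro map_cong refl trm_val_cong) auto
  then show ?case by (simp only: holds.simps)
next
  case (Neg \<phi>)
  from Neg.IH[of e e'] Neg.prems show ?case by simp
next
  case (Conj \<phi> \<psi>)
  from Conj.IH(1)[of e e'] Conj.IH(2)[of e e'] Conj.prems show ?case by simp
next
  case (Disj \<phi> \<psi>)
  from Disj.IH(1)[of e e'] Disj.IH(2)[of e e'] Disj.prems show ?case by simp
next
  case (Exists v \<phi>)
  have "holds A X (e(v := a)) \<phi> = holds A Y (e'(v := a)) \<phi>" for a
    using Exists.prems by (intro Exists.IH) auto
  then show ?case by simp
next
  case (Forall v \<phi>)
  have "holds A X (e(v := a)) \<phi> = holds A Y (e'(v := a)) \<phi>" for a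
    using Forall.prems by (intro Forall.IH) auto
  then show ?case by simp
qed simp

lemma tuples_index_tuples:
  assumes A: "A \<in> structures \<sigma>"
  shows "tuples (universe A) k = map ((!) (enumeration A)) ` set (index_tuples (size_of A) k)"
    (is "_ = ?R")
proof
  show "?R \<subseteq> tuples (universe A) k"
    using enumeration(1)[OF A, symmetric] by (auto simp: tuples_def set_index_tuples subset_iff)
  show "tuples (universe A) k \<subseteq> ?R"
  proof
    fix t assume t: "t \<in> tuples (universe A) k"
    have "\<forall>x \<in> set t. \<exists>i. i < size_of A \<and> enumeration A ! i = x"
      using t enumeration(1)[OF A] by (auto simp: tuples_def simp flip: in_set_conv_nth)
    then obtain g where g: "\<forall>x \<in> set t. g x < size_of A \<and> enumeration A ! g x = x"
      by (auto dest: bchoice)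
    then have "t = map ((!) (enumeration A)) (map g t)" by (simp add: map_idI)
    moreover have "map g t \<in> set (index_tuples (size_of A) k)"
      using g t by (auto simp: tuples_def set_index_tuples)
    ultimately show "t \<in> ?R" by blast
  qed
qed

lemma concat_map_if:
  "concat (map (\<lambda>x. if P x then f x else []) xs) = concat (map f (filter P xs))"
  by (induction xs) auto

text \<open>Brings the encoding into the shape of the output of nested loops: the filter becomes a
  test inside the inner loop.\<close>

lemma enc_cnf_reduction_cnf:
  "enc_cnf (reduction_cnf n m' k' H) = concat (map (\<lambda>b.
     let w = concat (map (\<lambda>c. if H b c then enc_literal (PosLit (tuple_var n c)) else [])
       (index_tuples n k'))
     in w @ [True, False] @ w @
       concat (map (\<lambda>c. enc_literal (PosLit (tuple_var n c))) (index_tuples n k')) @ [True, False])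
     (index_tuples n m'))"
proof -
  have "enc_cnf (concat (map (\<lambda>b. [f b, g b]) xs)) =
      concat (map (\<lambda>b. enc_clause (f b) @ enc_clause (g b)) xs)" for f g and xs :: "nat list list"
    by (induction xs) (auto simp: enc_cnf_def)
  then show ?thesis
    by (simp add: reduction_cnf_def reduction_clause_def enc_clause_def concat_map_if comp_def Let_def)
qed

section \<open>Symbols and tapes used by the programs\<close>

lemma ternary_routines [simp]:
  "ternary (emit v b)" "ternary (rewind v)" "ternary (advance v)" "ternary (set_flag b)"
  "ternary (read_flag x)" "ternary seek_tables"
  by (simp_all add: emit_def rewind_def set_flag_def read_flag_def seek_tables_def advance_def)

lemma ternary_emit_word [simp]: "ternary (emit_word x bs)"
  by (induction bs) auto

lemma ternary_sweep [simp]: "ternary (sweep x a p) = ternary p"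
  "ternary (for_each x p) = ternary p"
  by (simp_all add: sweep_def for_each_def)

lemma ternary_lookup_routines [simp]:
  "ternary (skip j)" "ternary (skips js)" "ternary (skip_to xs)" "ternary (lookup \<sigma> i xs)"
  "ternary (emit_indices js)" "ternary (copy_constant \<sigma> j)" "ternary (copy_constants \<sigma> js)"
proof -
  show *: "ternary (skip j)" for j by (induction j) auto
  show **: "ternary (skips js)" for js by (induction js) (auto simp: *)
  show ***: "ternary (skip_to xs)" by (induction xs) (auto simp: *)
  show "ternary (lookup \<sigma> i xs)" by (simp add: lookup_def ** ***)
  show "ternary (emit_indices js)" by (induction js) auto
  show c: "ternary (copy_constant \<sigma> j)" for j by (simp add: copy_constant_def **)
  show "ternary (copy_constants \<sigma> js)" by (induction js) (auto simp: c)
qed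

lemma ternary_compile: "ternary (compile \<sigma> \<phi> \<rho> d)"
  by (induction \<phi> arbitrary: \<rho> d) (auto simp: test_eq_def test_le_def junction_def quantifier_def)

lemma ternary_for_tuples: "ternary (for_tuples js p) = ternary p"
  unfolding for_tuples_def by (induction js) auto

lemma ternary_fills: "ternary (fills xs)"
  by (induction xs) (auto simp: fill_def)

lemma prog_tapes_fills: "prog_tapes (fills xs) \<subseteq> insert InT (set xs)"
  by (induction xs) (auto simp: fill_def emit_def sweep_def rewind_def)

section \<open>The reduction for a fixed sentence\<close>

locale Pi2_1VAR_problem =
  fixes \<sigma> :: vocabulary and ys zs :: "nat list" and \<phi> :: form
  assumes distinct: "distinct (ys @ zs)"
    and first_order: "first_order_over \<sigma> \<phi>"
    and free_vars: "free_vars \<phi> \<subseteq> set (ys @ zs)"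
begin

abbreviation "m \<equiv> length ys"
abbreviation "k \<equiv> length zs"

text \<open>Tapes below \<open>m\<close> hold \<open>ys\<close> and the next \<open>k\<close> hold
  \<open>zs\<close>. All other variables share the tape \<open>m + k\<close>, since compilation
  needs a bound for every variable; bound ones get tapes from \<open>Suc (m + k)\<close> on.\<close>

definition tape_of :: "nat \<Rightarrow> nat" where
  "tape_of = updates (\<lambda>_. m + k) (ys @ zs) [0..<m + k]"

lemma tape_of_nth: "i < m + k \<Longrightarrow> tape_of ((ys @ zs) ! i) = i"
  using updates_nth[OF distinct, of "[0..<m + k]" i] by (simp add: tape_of_def)

lemma tape_of_less: "tape_of v < Suc (m + k)"
proof (cases "v \<in> set (ys @ zs)")
  case True
  then obtain i where "i < m + k" "v = (ys @ zs) ! i" by (metis in_set_conv_nth length_append)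
  then show ?thesis using tape_of_nth by simp
qed (simp add: tape_of_def updates_notin del: set_append)

definition matrix :: "'a ordered_struct \<Rightarrow> nat list \<Rightarrow> nat list \<Rightarrow> bool" where
  "matrix A b c \<longleftrightarrow> holds A {} (env A tape_of (updates (\<lambda>_. 0) [0..<m + k] (b @ c))) \<phi>"

definition reduction :: "'a ordered_struct \<Rightarrow> cnf" where
  "reduction A = reduction_cnf (size_of A) m k (matrix A)"

lemma monotone_reduction: "monotone_cnf (reduction A)"
  by (auto simp: monotone_cnf_def reduction_def reduction_cnf_def reduction_clause_def)

text \<open>Both environments give variable \<open>i\<close> of \<open>ys @ zs\<close> the element
  with index \<open>(b @ c) ! i\<close>. Elsewhere they may differ, which is harmless because
  \<open>\<phi>\<close> has no further free variables.\<close>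

lemma matrix_holds:
  fixes A :: "'a ordered_struct"
  assumes "length b = m" "length c = k"
  shows "holds A X (updates (updates e ys (map ((!) (enumeration A)) b)) zs (map ((!) (enumeration A)) c)) \<phi>
    = matrix A b c"
  unfolding matrix_def
proof (rule holds_cong[OF first_order], rule ballI)
  fix v assume "v \<in> free_vars \<phi>"
  then have "v \<in> set (ys @ zs)" using free_vars by blast
  then obtain i where i: "i < m + k" "v = (ys @ zs) ! i" by (metis in_set_conv_nth length_append)
  have "updates (updates e ys (map ((!) (enumeration A)) b)) zs (map ((!) (enumeration A)) c) =
      updates e (ys @ zs) (map ((!) (enumeration A)) (b @ c))"
    using assms by (simp add: updates_append)
  then have "updates (updates e ys (map ((!) (enumeration A)) b)) zs (map ((!) (enumeration A)) c) v =
      enumeration A ! ((b @ c) ! i)"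
    using updates_nth[OF distinct, of "map ((!) (enumeration A)) (b @ c)" i e] assms i
    by (simp del: map_append)
  moreover have "updates (\<lambda>_. 0) [0..<m + k] (b @ c) i = (b @ c) ! i"
    using updates_nth[of "[0..<m + k]" "b @ c" i "\<lambda>_. 0"] assms i by simp
  ultimately show "updates (updates e ys (map ((!) (enumeration A)) b)) zs
      (map ((!) (enumeration A)) c) v = env A tape_of (updates (\<lambda>_. 0) [0..<m + k] (b @ c)) v"
    using tape_of_nth[OF i(1)] i(2) by (simp add: env_def)
qed

lemma models_iff:
  fixes A :: "'a ordered_struct"
  assumes A: "A \<in> structures \<sigma>"
  shows "models A X (foldr Forall ys (foldr Exists zs (Conj \<phi> (SOAtom (map Var zs))))) \<longleftrightarrow>
    (\<forall>b \<in> set (index_tuples (size_of A) m). \<exists>c \<in> set (index_tuples (size_of A) k).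
       matrix A b c \<and> map ((!) (enumeration A)) c \<in> X)"
proof -
  let ?x = "map ((!) (enumeration A))"
  let ?\<psi> = "Conj \<phi> (SOAtom (map Var zs))"
  have body: "holds A X (updates (updates e ys (?x b)) zs (?x c)) ?\<psi> \<longleftrightarrow> matrix A b c \<and> ?x c \<in> X"
    if "b \<in> set (index_tuples (size_of A) m)" "c \<in> set (index_tuples (size_of A) k)" for e b c
  proof -
    have "trm_val A e' \<circ> Var = e'" for e' by (simp add: fun_eq_iff)
    then show ?thesis
      using that matrix_holds[of b c A X e] distinct
        map_updates[of zs "?x c" "updates e ys (?x b)"]
      by (simp add: set_index_tuples)
  qed
  let ?R = "\<forall>b \<in> set (index_tuples (size_of A) m). \<exists>c \<in> set (index_tuples (size_of A) k).
       matrix A b c \<and> ?x c \<in> X"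
  have holds: "holds A X e (foldr Forall ys (foldr Exists zs ?\<psi>)) \<longleftrightarrow> ?R" for e
    unfolding holds_foldr_Forall holds_foldr_Exists tuples_index_tuples[OF A]
    using body by (simp del: holds.simps)
  \<comment> \<open>\<open>models\<close> quantifies over all environments in the universe. The
    truth value does not depend on the environment, but one has to exist for the direction from left
    to right.\<close>
  have "enumeration A ! 0 \<in> universe A"
    using nth_mem[OF size_of_pos[OF A]] enumeration(1)[OF A] by simp
  then have "\<exists>e :: nat \<Rightarrow> 'a. range e \<subseteq> universe A"
    by (intro exI[of _ "\<lambda>_. enumeration A ! 0"]) auto
  then show ?thesis unfolding models_def holds by simp
qed

lemma count_reduction:
  fixes A :: "'a ordered_struct"
  assumes A: "A \<in> structures \<sigma>"
  shows "card {X. X \<subseteq> tuples (universe A) k \<and>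
      models A X (foldr Forall ys (foldr Exists zs (Conj \<phi> (SOAtom (map Var zs)))))} =
    sharp_sat (reduction A)"
proof -
  let ?x = "map ((!) (enumeration A))"
  let ?I = "set (index_tuples (size_of A) m)" and ?J = "set (index_tuples (size_of A) k)"
  have inj: "inj_on ?x ?J"
  proof (rule inj_onI)
    fix c c' assume "c \<in> ?J" "c' \<in> ?J" "?x c = ?x c'"
    moreover have "inj_on ((!) (enumeration A)) {..<size_of A}"
      using enumeration(2)[OF A] by (simp add: inj_on_nth)
    ultimately show "c = c'"
      by (intro map_inj_on[of "(!) (enumeration A)" c c'])
         (auto simp: set_index_tuples intro: inj_on_subset[where A = "{..<size_of A}"])
  qed
  have "(\<forall>b \<in> ?I. \<exists>c \<in> ?J. matrix A b c \<and> ?x c \<in> ?x ` Y) \<longleftrightarrow> (\<forall>b \<in> ?I. \<exists>c \<in> Y. matrix A b c)"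
    if "Y \<subseteq> ?J" for Y
    using inj_on_image_mem_iff[OF inj _ that] that by blast
  then have "{Y. Y \<subseteq> ?J \<and> (\<forall>b \<in> ?I. \<exists>c \<in> ?J. matrix A b c \<and> ?x c \<in> ?x ` Y)} =
      {Y. Y \<subseteq> ?J \<and> (\<forall>b \<in> ?I. \<exists>c \<in> Y. matrix A b c)}" by blast
  then show ?thesis
    unfolding models_iff[OF A] tuples_index_tuples[OF A] card_subsets_image[OF inj]
    using sharp_sat_reduction_cnf[OF size_of_pos[OF A]] by (simp add: reduction_def)
qed

text \<open>The first doubled bit is the positive sign, the second the leading 1 of the number of
  the variable; the one-hot blocks then supply the remaining digits.\<close>

definition literal_prog :: "tape_name prog" where
  "literal_prog = emit_word OutT [True, True, True, True] ;; emit_indices [m..<m + k] ;;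
     emit_word OutT [False, True]"

lemma emits_literal:
  "emits \<sigma> literal_prog Z (\<lambda>A e. enc_literal (PosLit (tuple_var (size_of A) (map e [m..<m + k]))))"
  using emits_Seq[OF emits_word[of \<sigma> "[True, True, True, True]" Z]
      emits_Seq[OF emits_indices[of \<sigma> "[m..<m + k]" Z] emits_word[of \<sigma> "[False, True]" Z]]]
  by (simp add: literal_prog_def tuple_var_def enc_nat_bin_value comp_def)

text \<open>The end marker is left out, so that the same program writes a plain clause and the
  beginning of its padded copy.\<close>

definition clause_prog :: "tape_name prog" where
  "clause_prog = for_tuples [m..<m + k]
     (compile \<sigma> \<phi> tape_of (Suc (m + k)) ;;
      Cond FlagT (bit_sym True) (set_flag False ;; literal_prog) Nop)"

definition reduction_prog :: "tape_name prog" where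
  "reduction_prog = for_tuples [0..<m]
     (clause_prog ;; emit_word OutT [True, False] ;;
      clause_prog ;; for_tuples [m..<m + k] literal_prog ;; emit_word OutT [True, False])"

text \<open>The emitted word is a function of the initial indices, but the machine starts with all
  of them 0, so only that value has to be identified.\<close>

lemma emits_reduction:
  obtains Z and f :: "'a ordered_struct \<Rightarrow> (nat \<Rightarrow> nat) \<Rightarrow> bool list"
  where "emits \<sigma> reduction_prog Z f" "\<And>A. f A (\<lambda>_. 0) = enc_cnf (reduction A)"
proof -
  let ?Z = "{Suc (m + k)..}"
  let ?z = "[m..<m + k]"
  let ?l = "\<lambda>A :: 'a ordered_struct. \<lambda>c. enc_literal (PosLit (tuple_var (size_of A) c))"
  let ?h = "\<lambda>A e. holds A {} (env A tape_of e) \<phi>"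
  have ev: "evaluates \<sigma> (compile \<sigma> \<phi> tape_of (Suc (m + k))) (Suc (m + k)) ?h"
    by (rule evaluates_compile[OF first_order]) (simp add: tape_of_less)
  have disj: "{m..<m + k} \<inter> ?Z = {}" by auto
  have cl: "emits \<sigma> clause_prog (set ?z \<union> ?Z) (\<lambda>A e. concat (map
      (\<lambda>c. if ?h A (updates e ?z c) then ?l A (map (updates e ?z c) ?z) else [])
      (index_tuples (size_of A) k)))"
    using emits_for_tuples[OF emits_if[OF ev emits_literal order_refl], of ?z] disj
    by (simp add: clause_prog_def)
  have al: "emits \<sigma> (for_tuples ?z literal_prog) (set ?z \<union> ?Z) (\<lambda>A e. concat (map
      (\<lambda>c. ?l A (map (updates e ?z c) ?z)) (index_tuples (size_of A) k)))"
    using emits_for_tuples[OF emits_literal[of ?Z], of ?z] disj by simp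
  note wd = emits_word[of \<sigma> "[True, False]" "set ?z \<union> ?Z"]
  note all = emits_for_tuples[OF emits_Seq[OF cl emits_Seq[OF wd emits_Seq[OF cl emits_Seq[OF al wd]]]],
      of "[0..<m]", folded reduction_prog_def]
  have "set [0..<m] \<inter> (set ?z \<union> ?Z) = {}" by auto
  note all = all[OF distinct_upt this]
  show thesis
  proof (rule that[OF all])
    fix A :: "'a ordered_struct"
    \<comment> \<open>The outer loops set the first \<open>m\<close> tapes and the inner loops the
      next \<open>k\<close>; together this is the single assignment used in
      \<open>matrix\<close>.\<close>
    have up: "updates (updates (\<lambda>_. 0) [0..<m] b) ?z c = updates (\<lambda>_. 0) [0..<m + k] (b @ c)"
      if "b \<in> set (index_tuples (size_of A) m)" for b c
      using that updates_append[of "[0..<m]" b "\<lambda>_. 0" ?z c] upt_add_eq_append[of 0 m k]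
      by (simp add: set_index_tuples)
    have mu: "map (updates (\<lambda>_. 0) [0..<m + k] (b @ c)) ?z = c"
      if "b \<in> set (index_tuples (size_of A) m)" "c \<in> set (index_tuples (size_of A) k)" for b c
      using that(2) map_updates[of ?z c] by (simp add: set_index_tuples flip: up[OF that(1)])
    show "concat (map (\<lambda>is. concat (map (\<lambda>c.
          if ?h A (updates (updates (\<lambda>_. 0) [0..<m] is) ?z c)
          then ?l A (map (updates (updates (\<lambda>_. 0) [0..<m] is) ?z c) ?z) else [])
          (index_tuples (size_of A) k)) @ [True, False] @
        concat (map (\<lambda>c.
          if ?h A (updates (updates (\<lambda>_. 0) [0..<m] is) ?z c)
          then ?l A (map (updates (updates (\<lambda>_. 0) [0..<m] is) ?z c) ?z) else [])
          (index_tuples (size_of A) k)) @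
        concat (map (\<lambda>c. ?l A (map (updates (updates (\<lambda>_. 0) [0..<m] is) ?z c) ?z))
          (index_tuples (size_of A) k)) @ [True, False])
        (index_tuples (size_of A) (length [0..<m]))) = enc_cnf (reduction A)"
      unfolding reduction_def enc_cnf_reduction_cnf Let_def matrix_def length_upt minus_nat.diff_0
      by (intro arg_cong[of _ _ concat] map_cong refl arg_cong2[of _ _ _ _ "(@)"])
         (auto simp: up mu)
  qed
qed

definition full_prog :: "tape_name list \<Rightarrow> tape_name prog" where
  "full_prog fl = fills fl ;; Wr FlagT (bit_sym False) ;;
     copy_constants \<sigma> [0..<const_count \<sigma>] ;; reduction_prog"

lemma runs_full_prog:
  assumes fl: "distinct fl" "set fl \<inter> {InT, FlagT, OutT} = {}"
  shows "\<exists>q. \<forall>(A :: 'a ordered_struct) \<in> structures \<sigma>. \<exists>s s'.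
      runs (full_prog fl) s s' (poly q (length (enc_struct \<sigma> A))) \<and>
      s InT = (contents (enc_struct \<sigma> A), 0) \<and>
      (\<forall>v \<in> set (FlagT # fl @ [OutT]). s v = (contents [], 0)) \<and>
      fst (s' OutT) = contents (enc_cnf (reduction A))"
proof -
  obtain Z and f :: "'a ordered_struct \<Rightarrow> (nat \<Rightarrow> nat) \<Rightarrow> bool list"
    where f: "emits \<sigma> reduction_prog Z f" "\<And>A. f A (\<lambda>_. 0) = enc_cnf (reduction A)"
    using emits_reduction by blast
  obtain q1 where q1: "\<And>A e w. A \<in> structures \<sigma> \<Longrightarrow> (\<forall>j. e j < size_of A) \<Longrightarrow> (\<forall>j\<in>Z. e j = 0) \<Longrightarrow>
     runs reduction_prog (store \<sigma> A (const_index \<sigma> A) False e w)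
       (store \<sigma> A (const_index \<sigma> A) False e (w @ f A e)) (poly q1 (length (enc_struct \<sigma> A)))"
    using f(1) by (rule emitsE) blast
  obtain q2 where q2: "\<forall>(A :: 'a ordered_struct) \<in> structures \<sigma>. \<forall>ci r e w.
    (\<forall>c \<in> set [0..<const_count \<sigma>]. ci c = 0) \<longrightarrow>
    runs (copy_constants \<sigma> [0..<const_count \<sigma>]) (store \<sigma> A ci r e w)
      (store \<sigma> A (\<lambda>c. if c \<in> set [0..<const_count \<sigma>] then const_index \<sigma> A c else ci c) r e w)
      (poly q2 (length (enc_struct \<sigma> A)))"
    using runs_copy_constants[of "[0..<const_count \<sigma>]" \<sigma>] by auto
  \<comment> \<open>Besides \<open>q1\<close> and \<open>q2\<close>: the cost of the fills, one step
    to write the flag and three sequencing steps.\<close>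
  let ?q = "q1 + q2 + [:5 + 21 * length fl, 10 * length fl:]"
  have "\<exists>s s'. runs (full_prog fl) s s' (poly ?q (length (enc_struct \<sigma> A))) \<and>
      s InT = (contents (enc_struct \<sigma> A), 0) \<and>
      (\<forall>v \<in> set (FlagT # fl @ [OutT]). s v = (contents [], 0)) \<and>
      fst (s' OutT) = contents (enc_cnf (reduction A))"
    if A: "A \<in> structures \<sigma>" for A :: "'a ordered_struct"
  proof -
    let ?N = "length (enc_struct \<sigma> A)"
    define st where "st ci w = store \<sigma> A ci False (\<lambda>_. 0) w" for ci w
    \<comment> \<open>\<open>runs\<close> compares stores on all tape names, while only finitely
      many are tapes of the machine. Apart from the flag and the output, tapes outside
      \<open>fl\<close> carry their \<open>store\<close> contents from the start, so that
      initialization ends exactly in a \<open>store\<close>.\<close>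
    define s where "s v = (if v \<in> set fl \<union> {FlagT, OutT} then bits_tape [] 0 else st (\<lambda>_. 0) [] v)" for v
    let ?s1 = "\<lambda>v. if v \<in> set fl then index_tape (size_of A) 0 else s v"
    have 1: "runs (fills fl) s ?s1 (length fl * (10 * ?N + 21) + 1)"
      by (rule runs_fills[where w = "enc_struct \<sigma> A"])
         (use fl size_of_pos[OF A] size_of_le[of A \<sigma>] in \<open>auto simp: s_def st_def enc_struct_tables\<close>)
    have 2: "runs (Wr FlagT (bit_sym False)) ?s1 (st (\<lambda>_. 0) []) 1"
    proof (rule runs_weaken[OF runs_write_end[where w = "[]"]])
      show "?s1(FlagT := bits_tape ([] @ [False]) (length [])) = st (\<lambda>_. 0) []"
      proof
        fix v
        show "(?s1(FlagT := bits_tape ([] @ [False]) (length []))) v = st (\<lambda>_. 0) [] v"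
          using fl by (cases v) (auto simp: s_def st_def)
      qed
    qed (use fl in \<open>auto simp: s_def\<close>)
    have "(\<lambda>c. if c \<in> set [0..<const_count \<sigma>] then const_index \<sigma> A c else 0) = const_index \<sigma> A"
      by (auto simp: const_index_def)
    then have 3: "runs (copy_constants \<sigma> [0..<const_count \<sigma>]) (st (\<lambda>_. 0) []) (st (const_index \<sigma> A) [])
        (poly q2 ?N)"
      using q2[rule_format, OF A, of "\<lambda>_. 0" False "\<lambda>_. 0" "[]"] by (simp add: st_def)
    have 4: "runs reduction_prog (st (const_index \<sigma> A) []) (st (const_index \<sigma> A) (enc_cnf (reduction A)))
        (poly q1 ?N)"
      using q1[OF A, of "\<lambda>_. 0" "[]"] size_of_pos[OF A] f(2) by (simp add: st_def)
    have "runs (full_prog fl) s (st (const_index \<sigma> A) (enc_cnf (reduction A))) (poly ?q ?N)"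
      unfolding full_prog_def
      by (rule runs_Seq[OF 1 runs_Seq[OF 2 runs_Seq[OF 3 4 order_refl] order_refl]])
         (simp add: algebra_simps)
    moreover have "s InT = (contents (enc_struct \<sigma> A), 0)"
      using fl by (simp add: s_def st_def bits_tape_def)
    moreover have "\<forall>v \<in> set (FlagT # fl @ [OutT]). s v = (contents [], 0)"
      by (auto simp: s_def bits_tape_def)
    moreover have "fst (st (const_index \<sigma> A) (enc_cnf (reduction A)) OutT) =
        contents (enc_cnf (reduction A))" by (simp add: st_def bits_tape_def)
    ultimately show ?thesis by blast
  qed
  then show ?thesis by blast
qed

lemma ternary_full_prog: "ternary (full_prog fl)"
  by (simp add: full_prog_def ternary_fills reduction_prog_def ternary_for_tuples
      clause_prog_def ternary_compile literal_prog_def)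

lemma poly_time_reduction:
  "poly_time_computable (enc_struct \<sigma>) (structures \<sigma>) enc_cnf
    (reduction :: 'a ordered_struct \<Rightarrow> cnf)"
proof -
  let ?p = "copy_constants \<sigma> [0..<const_count \<sigma>] ;; reduction_prog"
  \<comment> \<open>There is no circularity in filling all tapes of \<open>?p\<close>: the filling
    program itself uses only these tapes and the input.\<close>
  obtain fl where fl: "set fl = prog_tapes ?p - {InT, FlagT, OutT}" "distinct fl"
    using finite_distinct_list[of "prog_tapes ?p - {InT, FlagT, OutT}"] by auto
  show ?thesis
  proof (rule poly_time_computable_program[where p = "full_prog fl" and x = InT
        and names = "FlagT # fl @ [OutT]"])
    show "distinct (InT # FlagT # fl @ [OutT])" using fl by auto
    have "prog_tapes ?p \<subseteq> set (InT # FlagT # fl @ [OutT])" using fl(1) by auto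
    then show "prog_tapes (full_prog fl) \<subseteq> set (InT # FlagT # fl @ [OutT])"
      using prog_tapes_fills[of fl] by (auto simp: full_prog_def)
    show "\<exists>q. \<forall>(A :: 'a ordered_struct) \<in> structures \<sigma>. \<exists>s s'.
      runs (full_prog fl) s s' (poly q (length (enc_struct \<sigma> A))) \<and>
      s InT = (contents (enc_struct \<sigma> A), 0) \<and>
      (\<forall>v \<in> set (FlagT # fl @ [OutT]). s v = (contents [], 0)) \<and>
      fst (s' (last (FlagT # fl @ [OutT]))) = contents (enc_cnf (reduction A))"
      using runs_full_prog[of fl] fl by auto
  qed (auto simp: ternary_full_prog)
qed

end

section \<open>The constant factor and the product reduction\<close>

lemma poly_time_constant: "poly_time_computable enc D enc' (\<lambda>_. y)"
proof (rule poly_time_computable_program[where p = "emit_word OutT (enc' y)" and x = InT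
      and names = "[OutT]"])
  show "prog_tapes (emit_word OutT (enc' y)) \<subseteq> set [InT, OutT]"
  proof -
    have "prog_tapes (emit_word OutT bs) \<subseteq> {OutT}" for bs
      by (induction bs) (auto simp: emit_def)
    then show ?thesis by auto
  qed
  show "ternary (emit_word OutT (enc' y))" by (rule ternary_emit_word)
  have "\<exists>s s'. runs (emit_word OutT (enc' y)) s s' (poly [:4 * length (enc' y) + 1:] (length (enc a))) \<and>
      s InT = (contents (enc a), 0) \<and> (\<forall>v \<in> set [OutT]. s v = (contents [], 0)) \<and>
      fst (s' (last [OutT])) = contents (enc' y)" for a
  proof (intro exI conjI)
    let ?s = "\<lambda>v. if v = InT then bits_tape (enc a) 0 else bits_tape [] 0"
    show "runs (emit_word OutT (enc' y)) ?s
        (?s(OutT := bits_tape ([] @ enc' y) (length ([] @ enc' y))))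
        (poly [:4 * length (enc' y) + 1:] (length (enc a)))"
      by (rule runs_emit_word) auto
  qed (auto simp: bits_tape_def)
  then show "\<exists>q. \<forall>a \<in> D. \<exists>s s'. runs (emit_word OutT (enc' y)) s s' (poly q (length (enc a))) \<and>
      s InT = (contents (enc a), 0) \<and> (\<forall>v \<in> set [OutT]. s v = (contents [], 0)) \<and>
      fst (s' (last [OutT])) = contents (enc' y)"
    by blast
qed auto

theorem theorem5:
  fixes \<sigma> :: vocabulary
    and B :: "'a ordered_struct \<Rightarrow> nat"
  assumes "sharp_Pi2_1VAR \<sigma> B"
  shows "\<exists>g h. product_reduction
    (enc_struct \<sigma>) (structures \<sigma>) B
    enc_cnf sharp_MonotoneSat_instances sharp_sat
    g h"
proof -
  obtain ys zs \<phi> where problem: "distinct (ys @ zs)" "first_order_over \<sigma> \<phi>"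
      "free_vars \<phi> \<subseteq> set (ys @ zs)"
    and B: "\<forall>A \<in> structures \<sigma>. B A = card {X. X \<subseteq> tuples (universe A) (length zs) \<and>
      models A X (foldr Forall ys (foldr Exists zs (Conj \<phi> (SOAtom (map Var zs)))))}"
    using assms unfolding sharp_Pi2_1VAR_def by blast
  interpret Pi2_1VAR_problem \<sigma> ys zs \<phi>
    by unfold_locales (rule problem)+
  have "product_reduction (enc_struct \<sigma>) (structures \<sigma>) B
      enc_cnf sharp_MonotoneSat_instances sharp_sat reduction (\<lambda>_. 1)"
    unfolding product_reduction_def
    using B by (simp add: poly_time_reduction poly_time_constant count_reduction monotone_reduction)
  then show ?thesis by blast
qed

end
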